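(* Let $I \subseteq A$ and $J \subseteq B$ be monomial ideals. Suppose that $\nu^*_\alpha(I) \in \mathbb{Z}$ for every $\alpha \in \mathbb{N}^r$. Then for every $k \in \mathbb{N}$, $$\overline{(I+J)^k} = \sum_{\ell=0}^{k} \overline{I^\ell}\cdot \overline{J^{k-\ell}}$$ in $S$.
   Context: $\mathbbm{k}$ is a field, $A = \mathbbm{k}[X_1,\dots,X_r]$, $B = \mathbbm{k}[Y_1,\dots,Y_s]$, $S = A\otimes_{\mathbbm{k}} B$; ideals of $A$ and $B$ and their integral closures are identified with their extensions to $S$. $\overline{\,\cdot\,}$ denotes integral closure, with $\overline{I^0} = A$. For a monomial ideal $I\subseteq A$ with minimal monomial generators whose exponent vectors form the columns of the $r\times m$ matrix $M$, and $\alpha\in\mathbb{N}^r$, $\nu^*_{\alpha}(I)$ is the optimal value of the linear program: maximize $\mathbf{1}^m\cdot \mathbf{y}$ subject to $M\mathbf{y} \le \alpha$, $\mathbf{y}\in\mathbb{R}^m_{\ge 0}$. *)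

theory Defs
  imports "HOL-Library.Poly_Mapping" "HOL-Library.Extended_Real"
begin

type_synonym ('v, 'k) mpoly = "('v \<Rightarrow>\<^sub>0 nat) \<Rightarrow>\<^sub>0 'k"

definition is_ideal :: "'a::comm_ring_1 set \<Rightarrow> bool" where
  "is_ideal J \<longleftrightarrow> 0 \<in> J \<and> (\<forall>a\<in>J. \<forall>b\<in>J. a + b \<in> J) \<and> (\<forall>r a. a \<in> J \<longrightarrow> r * a \<in> J)"

definition ideal_of :: "'a::comm_ring_1 set \<Rightarrow> 'a set" where
  "ideal_of X = \<Inter> {J. is_ideal J \<and> X \<subseteq> J}"

definition ideal_sum :: "'a::comm_ring_1 set \<Rightarrow> 'a set \<Rightarrow> 'a set" where
  "ideal_sum I J = ideal_of (I \<union> J)"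

definition ideal_Sum :: "('i \<Rightarrow> 'a::comm_ring_1 set) \<Rightarrow> 'i set \<Rightarrow> 'a set" where
  "ideal_Sum F L = ideal_of (\<Union>l\<in>L. F l)"

definition ideal_prod :: "'a::comm_ring_1 set \<Rightarrow> 'a set \<Rightarrow> 'a set" where
  "ideal_prod I J = ideal_of {a * b | a b. a \<in> I \<and> b \<in> J}"

primrec ideal_pow :: "'a::comm_ring_1 set \<Rightarrow> nat \<Rightarrow> 'a set" where
  "ideal_pow I 0 = UNIV"
| "ideal_pow I (Suc n) = ideal_prod I (ideal_pow I n)"

definition int_closure :: "'a::comm_ring_1 set \<Rightarrow> 'a set" where
  "int_closure I = {x. \<exists>n\<ge>1. \<exists>a :: nat \<Rightarrow> 'a.
      (\<forall>i\<in>{1..n}. a i \<in> ideal_pow I i) \<and> x ^ n + (\<Sum>i=1..n. a i * x ^ (n - i)) = 0}"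

definition monom :: "('v \<Rightarrow>\<^sub>0 nat) \<Rightarrow> ('v, 'k::comm_ring_1) mpoly" where
  "monom e = Poly_Mapping.single e 1"

definition monomial_ideal :: "('v, 'k::comm_ring_1) mpoly set \<Rightarrow> bool" where
  "monomial_ideal I \<longleftrightarrow> (\<exists>G. I = ideal_of (monom ` G))"

definition exp_le :: "('v \<Rightarrow>\<^sub>0 nat) \<Rightarrow> ('v \<Rightarrow>\<^sub>0 nat) \<Rightarrow> bool" where
  "exp_le e f \<longleftrightarrow> (\<forall>v. Poly_Mapping.lookup e v \<le> Poly_Mapping.lookup f v)"

definition mingens :: "('v, 'k::comm_ring_1) mpoly set \<Rightarrow> ('v \<Rightarrow>\<^sub>0 nat) set" where
  "mingens I = {e. monom e \<in> I \<and> (\<forall>f. monom f \<in> I \<and> exp_le f e \<longrightarrow> f = e)}"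

text \<open>The LP value nu*_alpha(I): maximise the sum of y over the minimal generators subject
  to M y \<le> alpha, y \<ge> 0 (value in the extended reals; +\<infinity> if unbounded).\<close>
definition nu_star :: "('v, 'k::comm_ring_1) mpoly set \<Rightarrow> ('v \<Rightarrow> nat) \<Rightarrow> ereal" where
  "nu_star I \<alpha> = Sup {ereal (\<Sum>g\<in>mingens I. y g) | y :: ('v \<Rightarrow>\<^sub>0 nat) \<Rightarrow> real.
      (\<forall>g. 0 \<le> y g) \<and> (\<forall>v. (\<Sum>g\<in>mingens I. y g * real (Poly_Mapping.lookup g v)) \<le> real (\<alpha> v))}"

definition expA :: "('x \<Rightarrow>\<^sub>0 nat) \<Rightarrow> ('x + 'y \<Rightarrow>\<^sub>0 nat)" where
  "expA e = Abs_poly_mapping (\<lambda>v. case v of Inl x \<Rightarrow> Poly_Mapping.lookup e x | Inr _ \<Rightarrow> 0)"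

definition expB :: "('y \<Rightarrow>\<^sub>0 nat) \<Rightarrow> ('x + 'y \<Rightarrow>\<^sub>0 nat)" where
  "expB e = Abs_poly_mapping (\<lambda>v. case v of Inl _ \<Rightarrow> 0 | Inr y \<Rightarrow> Poly_Mapping.lookup e y)"

definition embA :: "('x::finite, 'k::comm_ring_1) mpoly \<Rightarrow> ('x + 'y::finite, 'k) mpoly" where
  "embA p = (\<Sum>e\<in>Poly_Mapping.keys p. Poly_Mapping.single (expA e) (Poly_Mapping.lookup p e))"

definition embB :: "('y::finite, 'k::comm_ring_1) mpoly \<Rightarrow> ('x::finite + 'y, 'k) mpoly" where
  "embB p = (\<Sum>e\<in>Poly_Mapping.keys p. Poly_Mapping.single (expB e) (Poly_Mapping.lookup p e))"

definition extA :: "('x::finite, 'k::comm_ring_1) mpoly set \<Rightarrow> ('x + 'y::finite, 'k) mpoly set" where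
  "extA I = ideal_of (embA ` I)"

definition extB :: "('y::finite, 'k::comm_ring_1) mpoly set \<Rightarrow> ('x::finite + 'y, 'k) mpoly set" where
  "extB J = ideal_of (embB ` J)"

end

theory Submission
  imports "Jordan_Normal_Form.Determinant" Defs
begin

text \<open>
  Monomial ideals correspond to up-closed sets \<open>U\<close> of exponents, and the integral closure of the
  ideal of \<open>U\<close> is spanned by the monomials \<open>X^e\<close> such that \<open>N e\<close> dominates a sum of \<open>N\<close> elements
  of \<open>U\<close> for some \<open>N \<ge> 1\<close>. That such monomials span integral elements is the determinant trick;
  conversely, if \<open>e\<close> is not of this form, then by Farkas' lemma over the rationals a nonnegative
  weight separates \<open>e\<close> from \<open>U\<close>, and the order of vanishing along that weight obstructs every
  integral equation of a polynomial containing \<open>X^e\<close>.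

  For \<open>X^a Y^b\<close> in the integral closure of \<open>(I + J)^k\<close> there are \<open>N \<ge> 1\<close> and \<open>p + q = k N\<close> with
  \<open>X^(N a) \<in> I^p\<close> and \<open>Y^(N b) \<in> J^q\<close>. If \<open>\<nu>\<close> is the value of the linear program at \<open>a\<close>, then
  \<open>p \<le> \<nu> N\<close>, hence \<open>q \<ge> (k - \<nu>) N\<close>, so \<open>Y^b\<close> is integral over \<open>J^(k - \<nu>)\<close>; and \<open>X^a\<close> is integral
  over \<open>I^\<nu>\<close> since the optimum is attained at a rational point. Integrality of \<open>\<nu>\<close> is what makes
  these powers meaningful; one takes \<open>l = min \<nu> k\<close>.
\<close>

subsection \<open>Ideals\<close>

lemma is_idealD:
  assumes "is_ideal K"
  shows "0 \<in> K" "a \<in> K \<Longrightarrow> b \<in> K \<Longrightarrow> a + b \<in> K" "a \<in> K \<Longrightarrow> r * a \<in> K"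
    "a \<in> K \<Longrightarrow> a * r \<in> K" "a \<in> K \<Longrightarrow> - a \<in> K"
    "a \<in> K \<Longrightarrow> b \<in> K \<Longrightarrow> a - b \<in> K"
proof -
  have minus: "- a \<in> K" if "a \<in> K" for a
  proof -
    have "(- 1) * a \<in> K" using assms that unfolding is_ideal_def by blast
    then show ?thesis by simp
  qed
  then show "a \<in> K \<Longrightarrow> - a \<in> K" .
  show "a - b \<in> K" if "a \<in> K" "b \<in> K"
  proof -
    have "a + - b \<in> K" using assms that minus unfolding is_ideal_def by blast
    then show ?thesis by simp
  qed
  show "a \<in> K \<Longrightarrow> a * r \<in> K"
    using assms unfolding is_ideal_def by (metis mult.commute)
qed (use assms in \<open>auto simp: is_ideal_def\<close>)

lemma is_ideal_sum:
  assumes "is_ideal K" "\<And>i. i \<in> A \<Longrightarrow> f i \<in> K"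
  shows "sum f A \<in> K"
  using assms(2)
proof (induction A rule: infinite_finite_induct)
  case (insert x F)
  then show ?case using is_idealD(2)[OF assms(1)] by auto
qed (use is_idealD(1)[OF assms(1)] in auto)

lemma is_ideal_ideal_of: "is_ideal (ideal_of X)"
  unfolding ideal_of_def is_ideal_def by blast

lemma subset_ideal_of: "X \<subseteq> ideal_of X"
  unfolding ideal_of_def by blast

lemma ideal_of_subset: "is_ideal K \<Longrightarrow> X \<subseteq> K \<Longrightarrow> ideal_of X \<subseteq> K"
  unfolding ideal_of_def by blast

lemma is_ideal_ideal_pow: "is_ideal (ideal_pow L n)"
proof (cases n)
  case 0
  then show ?thesis by (simp add: is_ideal_def)
next
  case (Suc m)
  then show ?thesis by (simp add: ideal_prod_def is_ideal_ideal_of)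
qed

lemma ideal_pow_Suc_memI: "a \<in> L \<Longrightarrow> b \<in> ideal_pow L n \<Longrightarrow> a * b \<in> ideal_pow L (Suc n)"
  unfolding ideal_pow.simps ideal_prod_def by (rule subsetD[OF subset_ideal_of]) blast

lemma mult_mem_ideal_pow_add:
  assumes "a \<in> ideal_pow L m" "b \<in> ideal_pow L n"
  shows "a * b \<in> ideal_pow L (m + n)"
  using assms(1)
proof (induction m arbitrary: a)
  case 0
  then show ?case using is_idealD(3)[OF is_ideal_ideal_pow assms(2)] by simp
next
  case (Suc m)
  \<comment> \<open>An ideal that contains the generating products contains all of
    \<open>ideal_prod L (ideal_pow L m)\<close>, so this colon ideal reduces the claim to products
    \<open>x * y\<close>.\<close>
  let ?K = "{x. x * b \<in> ideal_pow L (Suc m + n)}"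
  have "is_ideal ?K"
    unfolding is_ideal_def
    using is_idealD[OF is_ideal_ideal_pow[of L "Suc m + n"]]
    by (auto simp: distrib_right mult.assoc)
  moreover have "{x * y |x y. x \<in> L \<and> y \<in> ideal_pow L m} \<subseteq> ?K"
    using Suc.IH ideal_pow_Suc_memI by (fastforce simp: mult.assoc)
  ultimately show ?case
    using Suc.prems ideal_of_subset unfolding ideal_pow.simps ideal_prod_def by blast
qed

subsection \<open>The determinant trick\<close>

text \<open>The degree \<open>n\<close> forms in \<open>f\<close> and \<open>L\<close> whose degree in \<open>L\<close> is at least \<open>s\<close>.\<close>

definition closure_form :: "'a::comm_ring_1 set \<Rightarrow> 'a \<Rightarrow> nat \<Rightarrow> nat \<Rightarrow> 'a set" where
  "closure_form L f s n = {\<Sum>i=s..n. b i * f ^ (n - i) | b. \<forall>i. b i \<in> ideal_pow L i}"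

lemma is_ideal_closure_form: "is_ideal (closure_form L f s n)"
  unfolding is_ideal_def
proof (intro conjI ballI allI impI)
  note P = is_idealD[OF is_ideal_ideal_pow[of L]]
  show "0 \<in> closure_form L f s n"
    unfolding closure_form_def by (rule CollectI, rule exI[of _ "\<lambda>_. 0"]) (simp add: P)
next
  note P = is_idealD[OF is_ideal_ideal_pow[of L]]
  fix x y assume "x \<in> closure_form L f s n" "y \<in> closure_form L f s n"
  then obtain b c where "\<forall>i. b i \<in> ideal_pow L i" "x = (\<Sum>i=s..n. b i * f ^ (n - i))"
    "\<forall>i. c i \<in> ideal_pow L i" "y = (\<Sum>i=s..n. c i * f ^ (n - i))"
    unfolding closure_form_def by blast
  then show "x + y \<in> closure_form L f s n"
    unfolding closure_form_def
    by (intro CollectI exI[of _ "\<lambda>i. b i + c i"]) (simp add: P sum.distrib distrib_right)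
next
  note P = is_idealD[OF is_ideal_ideal_pow[of L]]
  fix r x assume "x \<in> closure_form L f s n"
  then obtain b where "\<forall>i. b i \<in> ideal_pow L i" "x = (\<Sum>i=s..n. b i * f ^ (n - i))"
    unfolding closure_form_def by blast
  then show "r * x \<in> closure_form L f s n"
    unfolding closure_form_def
    by (intro CollectI exI[of _ "\<lambda>i. r * b i"]) (simp add: P sum_distrib_left mult.assoc)
qed

lemma closure_form_termI:
  assumes "b \<in> ideal_pow L i" "s \<le> i" "i \<le> n"
  shows "b * f ^ (n - i) \<in> closure_form L f s n"
  unfolding closure_form_def
proof (intro CollectI exI[of _ "\<lambda>j. if j = i then b else 0"] conjI allI)
  have "(\<Sum>j=s..n. (if j = i then b else 0) * f ^ (n - j)) = (\<Sum>j=s..n. if j = i then b * f ^ (n - i) else 0)"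
    by (intro sum.cong) auto
  then show "b * f ^ (n - i) = (\<Sum>j=s..n. (if j = i then b else 0) * f ^ (n - j))"
    using assms by simp
next
  fix j show "(if j = i then b else 0) \<in> ideal_pow L j"
    using assms by (simp add: is_idealD(1)[OF is_ideal_ideal_pow])
qed

text \<open>Powers of \<open>L\<close> multiply into powers of \<open>L\<close>, and
  \<open>(m - i) + (n - j) = m + n - (i + j)\<close> because \<open>i \<le> m\<close> and
  \<open>j \<le> n\<close>; so total degrees and lower bounds for the degree in \<open>L\<close>
  both add.\<close>

lemma mult_closure_form:
  assumes "x \<in> closure_form L f s m" "y \<in> closure_form L f t n"
  shows "x * y \<in> closure_form L f (s + t) (m + n)"
proof -
  obtain b c where bc: "\<forall>i. b i \<in> ideal_pow L i" "x = (\<Sum>i=s..m. b i * f ^ (m - i))"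
    "\<forall>i. c i \<in> ideal_pow L i" "y = (\<Sum>i=t..n. c i * f ^ (n - i))"
    using assms unfolding closure_form_def by blast
  have "b i * f ^ (m - i) * (c j * f ^ (n - j)) \<in> closure_form L f (s + t) (m + n)"
    if "i \<in> {s..m}" "j \<in> {t..n}" for i j
  proof -
    have "b i * f ^ (m - i) * (c j * f ^ (n - j)) = (b i * c j) * f ^ ((m - i) + (n - j))"
      by (simp add: power_add ac_simps)
    also have "(m - i) + (n - j) = m + n - (i + j)" using that by auto
    finally show ?thesis
      using closure_form_termI[OF mult_mem_ideal_pow_add[of "b i" L i "c j" j]] bc that by simp
  qed
  then show ?thesis
    unfolding bc(2,4) sum_product
    by (intro is_ideal_sum[OF is_ideal_closure_form]) auto
qed

lemma prod_closure_form:
  assumes "finite A" "\<And>i. i \<in> A \<Longrightarrow> x i \<in> closure_form L f (s i) (n i)"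
  shows "prod x A \<in> closure_form L f (sum s A) (sum n A)"
  using assms
proof (induction A rule: finite_induct)
  case empty
  have "1 * f ^ (0 - 0) \<in> closure_form L f 0 0"
    by (rule closure_form_termI) auto
  then show ?case by simp
qed (simp add: mult_closure_form)

lemma closure_form_antimono:
  assumes "s \<le> t" shows "closure_form L f t n \<subseteq> closure_form L f s n"
proof
  fix x assume "x \<in> closure_form L f t n"
  then obtain b where "\<forall>i. b i \<in> ideal_pow L i" "x = (\<Sum>i=t..n. b i * f ^ (n - i))"
    unfolding closure_form_def by blast
  then show "x \<in> closure_form L f s n"
    using assms by (auto intro!: is_ideal_sum[OF is_ideal_closure_form] closure_form_termI)
qed

lemma int_closureI:
  assumes "1 \<le> n" "y \<in> closure_form L f 1 n" "f ^ n + y = 0"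
  shows "f \<in> int_closure L"
proof -
  obtain b where "\<forall>i. b i \<in> ideal_pow L i" "y = (\<Sum>i=1..n. b i * f ^ (n - i))"
    using assms(2) unfolding closure_form_def by blast
  then show ?thesis using assms(1,3) unfolding int_closure_def by blast
qed

text \<open>Treats the diagonal of the determinant: every term of the expanded product other than
  \<open>f ^ card A\<close> contains some \<open>c i\<close> and thus has positive degree in
  \<open>L\<close>.\<close>

lemma prod_diff_closure_form:
  assumes "finite A" "\<And>i. i \<in> A \<Longrightarrow> c i \<in> ideal_pow L 1"
  shows "(\<Prod>i\<in>A. f - c i) - f ^ card A \<in> closure_form L f 1 (card A)"
  using assms
proof (induction A rule: finite_induct)
  case empty
  then show ?case using is_idealD(1)[OF is_ideal_closure_form] by simp
next
  case (insert x A)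
  let ?P = "\<Prod>i\<in>A. f - c i" and ?n = "card A"
  have f1: "1 * f ^ (1 - 0) \<in> closure_form L f 0 1"
    by (rule closure_form_termI) auto
  have c1: "c x * f ^ (1 - 1) \<in> closure_form L f 1 1"
    by (rule closure_form_termI) (use insert in auto)
  have P0: "?P - f ^ ?n \<in> closure_form L f 1 ?n" using insert by auto
  have fn: "1 * f ^ (?n - 0) \<in> closure_form L f 0 ?n"
    by (rule closure_form_termI) auto
  have "f * (?P - f ^ ?n) \<in> closure_form L f 1 (Suc ?n)"
    using mult_closure_form[OF f1 P0] by simp
  moreover have "c x * (?P - f ^ ?n) \<in> closure_form L f 1 (Suc ?n)"
    using mult_closure_form[OF c1 P0] closure_form_antimono[of 1 2 L f] by (auto simp: numeral_2_eq_2)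
  moreover have "c x * f ^ ?n \<in> closure_form L f 1 (Suc ?n)"
    using mult_closure_form[OF c1 fn] by simp
  moreover have "(\<Prod>i\<in>insert x A. f - c i) - f ^ card (insert x A)
      = f * (?P - f ^ ?n) + - (c x * (?P - f ^ ?n)) + - (c x * f ^ ?n)"
    using insert by (simp add: algebra_simps)
  ultimately show ?case
    using is_idealD(2,5)[OF is_ideal_closure_form[of L f 1 "Suc ?n"]] insert(1,2)
    by (metis card_insert_disjoint)
qed

text \<open>The generators \<open>g i\<close> carry degrees so that the relations are homogeneous, as in the Rees
  algebra of \<open>L\<close>; since one generator is 1, the determinant itself must vanish.\<close>

lemma determinant_trick:
  fixes f :: "'a::comm_ring_1" and deg :: "nat \<Rightarrow> nat"
  assumes n: "i0 < n" "g i0 = 1"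
    and rel: "\<And>i. i < n \<Longrightarrow> f * g i = (\<Sum>j<n. a i j * g j)"
    and mem: "\<And>i j. i < n \<Longrightarrow> j < n \<Longrightarrow> deg j \<le> deg i + 1 \<Longrightarrow> a i j \<in> ideal_pow L (deg i + 1 - deg j)"
    and zero: "\<And>i j. i < n \<Longrightarrow> j < n \<Longrightarrow> deg i + 1 < deg j \<Longrightarrow> a i j = 0"
  shows "f \<in> int_closure L"
proof -
  \<comment> \<open>The relations say exactly that \<open>B\<close> annihilates the vector of
    generators.\<close>
  define B where "B = mat n n (\<lambda>(i, j). (if i = j then f else 0) - a i j)"
  define v where "v = vec n g"
  have B: "B \<in> carrier_mat n n" and v: "v \<in> carrier_vec n"
    by (simp_all add: B_def v_def)
  have Bv: "B *\<^sub>v v = 0\<^sub>v n"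
  proof (rule eq_vecI)
    fix i assume "i < dim_vec (0\<^sub>v n)"
    then have i: "i < n" by simp
    have "(B *\<^sub>v v) $ i = (\<Sum>j<n. ((if i = j then f else 0) - a i j) * g j)"
      using i by (simp add: B_def v_def scalar_prod_def atLeast0LessThan)
    also have "\<dots> = (\<Sum>j<n. (if i = j then f * g j else 0) - a i j * g j)"
      by (intro sum.cong) (auto simp: algebra_simps)
    also have "\<dots> = f * g i - (\<Sum>j<n. a i j * g j)"
      using i by (simp add: sum_subtractf)
    finally show "(B *\<^sub>v v) $ i = 0\<^sub>v n $ i" using rel[OF i] i by simp
  qed (simp add: B_def)
  \<comment> \<open>The adjugate turns this into \<open>det B * g i = 0\<close> for all
    \<open>i\<close>; the entry at \<open>i0\<close>, where \<open>g\<close> is 1, leaves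
    \<open>det B = 0\<close>.\<close>
  have "(det B \<cdot>\<^sub>m 1\<^sub>m n) *\<^sub>v v = adj_mat B *\<^sub>v (B *\<^sub>v v)"
    using assoc_mult_mat_vec[OF adj_mat(1)[OF B] B v] adj_mat(3)[OF B] by simp
  also have "\<dots> = 0\<^sub>v n" unfolding Bv using adj_mat(1)[OF B] by auto
  finally have "((det B \<cdot>\<^sub>m 1\<^sub>m n) *\<^sub>v v) $ i0 = 0" using n by simp
  moreover have "((det B \<cdot>\<^sub>m 1\<^sub>m n) *\<^sub>v v) $ i0 = det B * g i0"
  proof -
    have "((det B \<cdot>\<^sub>m 1\<^sub>m n) *\<^sub>v v) $ i0 = (\<Sum>j<n. det B * (if j = i0 then 1 else 0) * g j)"
      using n(1) by (simp add: v_def scalar_prod_def atLeast0LessThan)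
    also have "\<dots> = (\<Sum>j<n. if j = i0 then det B * g j else 0)"
      by (intro sum.cong) auto
    finally show ?thesis using n(1) by simp
  qed
  ultimately have det0: "det B = 0" using n by simp
  have other: "(\<Prod>i = 0..<n. B $$ (i, p i)) \<in> closure_form L f 1 n"
    if p: "p permutes {0..<n}" "p \<noteq> id" for p
  proof (cases "\<exists>i<n. deg i + 1 < deg (p i)")
    case True
    then obtain i where i: "i < n" "deg i + 1 < deg (p i)" by blast
    have "p i < n" using permutes_in_image[OF p(1)] i by auto
    moreover have "p i \<noteq> i" using i by auto
    ultimately have "B $$ (i, p i) = 0" using i zero by (simp add: B_def)
    then have "(\<Prod>i = 0..<n. B $$ (i, p i)) = 0" using i by (intro prod_zero) auto
    then show ?thesis using is_idealD(1)[OF is_ideal_closure_form] by simp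
  next
    case False
    \<comment> \<open>\<open>d i\<close> is the total degree of the entry at \<open>(i, p i)\<close>
      and \<open>s i\<close> a lower bound for its degree in \<open>L\<close>, which is 0 at a fixed
      point because of the summand \<open>f\<close>. The numbers \<open>deg (p i)\<close> only
      permute the \<open>deg i\<close>, so the \<open>d i\<close> add up to
      \<open>n\<close>.\<close>
    define d where "d i = deg i + 1 - deg (p i)" for i
    define s where "s i = (if p i = i then 0 else d i)" for i
    have dadd: "d i + deg (p i) = deg i + 1" if "i < n" for i
      using False that by (force simp: d_def)
    have pn: "p i < n" if "i < n" for i using permutes_in_image[OF p(1)] that by auto
    have "(\<Sum>i=0..<n. d i) + (\<Sum>i=0..<n. deg (p i)) = (\<Sum>i=0..<n. deg i + 1)"
      unfolding sum.distrib[symmetric] by (intro sum.cong) (auto simp: dadd)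
    moreover have "(\<Sum>i=0..<n. deg (p i)) = (\<Sum>i=0..<n. deg i)"
      using sum.permute[OF p(1), of deg] by (simp add: o_def)
    ultimately have sd: "(\<Sum>i=0..<n. d i) = n" unfolding sum.distrib by simp
    have "B $$ (i, p i) \<in> closure_form L f (s i) (d i)" if i: "i \<in> {0..<n}" for i
    proof (cases "p i = i")
      case True
      have "1 * f ^ (1 - 0) \<in> closure_form L f 0 1" by (rule closure_form_termI) auto
      moreover have "a i i * f ^ (1 - 1) \<in> closure_form L f 0 1"
        using mem[of i i] i by (intro closure_form_termI) auto
      ultimately have "f - a i i \<in> closure_form L f 0 1"
        using is_idealD(6)[OF is_ideal_closure_form[of L f 0 1]] by simp
      then show ?thesis using True i by (simp add: B_def s_def d_def)
    next
      case False
      have "a i (p i) \<in> ideal_pow L (d i)"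
        using mem[of i "p i"] i pn[of i] dadd[of i] unfolding d_def by auto
      then have "a i (p i) * f ^ (d i - d i) \<in> closure_form L f (d i) (d i)"
        by (intro closure_form_termI) auto
      then show ?thesis
        using False i pn[of i] is_idealD(5)[OF is_ideal_closure_form[of L f "d i" "d i"]]
        by (simp add: B_def s_def)
    qed
    then have *: "(\<Prod>i = 0..<n. B $$ (i, p i)) \<in> closure_form L f (sum s {0..<n}) n"
      using prod_closure_form[of "{0..<n}" "\<lambda>i. B $$ (i, p i)" L f s d] sd by simp
    \<comment> \<open>If all \<open>s i\<close> vanished, then \<open>d i\<close> would be 1 at
      fixed points and 0 elsewhere; some index is moved, so the sum would fall below
      \<open>n\<close>.\<close>
    have "sum s {0..<n} \<noteq> 0"
    proof
      assume "sum s {0..<n} = 0"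
      then have s0: "s i = 0" if "i < n" for i using that by simp
      obtain i where "p i \<noteq> i" using p(2) by fastforce
      then have i: "i < n" using p(1) by (meson atLeastLessThan_iff le0 permutes_not_in)
      have "(\<Sum>i=0..<n. d i) < (\<Sum>i=0..<n. 1)"
      proof (rule sum_strict_mono_ex1)
        show "\<forall>i\<in>{0..<n}. d i \<le> 1"
        proof
          fix i assume "i \<in> {0..<n}"
          then show "d i \<le> 1"
            using s0[of i] by (cases "p i = i") (auto simp: s_def d_def)
        qed
        show "\<exists>i\<in>{0..<n}. d i < 1" using s0[OF i] i \<open>p i \<noteq> i\<close> by (auto simp: s_def)
      qed simp
      then show False using sd by simp
    qed
    then have "1 \<le> sum s {0..<n}" by linarith
    then show ?thesis using * closure_form_antimono by blast
  qed
  have idp: "(\<Prod>i = 0..<n. B $$ (i, id i)) - f ^ n \<in> closure_form L f 1 n"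
  proof -
    have "a i i \<in> ideal_pow L 1" if "i \<in> {0..<n}" for i
      using mem[of i i] that by simp
    then have "(\<Prod>i = 0..<n. f - a i i) - f ^ card {0..<n} \<in> closure_form L f 1 (card {0..<n})"
      by (intro prod_diff_closure_form) blast+
    then show ?thesis by (simp add: B_def)
  qed
  let ?Q = "{p. p permutes {0..<n}}"
  \<comment> \<open>The identity contributes \<open>f ^ n\<close> up to terms of positive degree in
    \<open>L\<close>, and all other permutations contribute only such terms. So
    \<open>det B = 0\<close> is an integral equation for \<open>f\<close>.\<close>
  have "det B = (\<Prod>i = 0..<n. B $$ (i, id i)) +
      (\<Sum>p\<in>?Q - {id}. signof p * (\<Prod>i = 0..<n. B $$ (i, p i)))"
    unfolding det_def'[OF B]
    by (subst sum.remove[of _ id]) (auto simp: finite_permutations permutes_id)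
  then have "det B = f ^ n + (((\<Prod>i = 0..<n. B $$ (i, id i)) - f ^ n) +
      (\<Sum>p\<in>?Q - {id}. signof p * (\<Prod>i = 0..<n. B $$ (i, p i))))" (is "_ = _ + ?y")
    by simp
  moreover have "?y \<in> closure_form L f 1 n"
    by (intro is_idealD(2)[OF is_ideal_closure_form idp] is_ideal_sum[OF is_ideal_closure_form]
        is_idealD(3)[OF is_ideal_closure_form] other) auto
  ultimately show ?thesis using int_closureI[of n ?y L f] det0 n by simp
qed

text \<open>The determinant trick is applied to the products of powers \<open>x e ^ d e\<close> with
  all \<open>d e < N\<close>. Multiplication by \<open>x e\<close> raises one exponent; when it
  reaches \<open>N\<close> it is reset to 0 at the cost of the coefficient \<open>x e ^ N\<close> in
  \<open>ideal_pow L N\<close>, which makes up for the lost degree exactly.\<close>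

lemma linear_combination_int_closure:
  fixes x c :: "'e \<Rightarrow> 'a::comm_ring_1"
  assumes E: "finite E" and N: "1 \<le> N" and pow: "\<And>e. e \<in> E \<Longrightarrow> x e ^ N \<in> ideal_pow L N"
  shows "(\<Sum>e\<in>E. c e * x e) \<in> int_closure L"
proof -
  define D where "D = E \<rightarrow>\<^sub>E {0..<N}"
  define g where "g d = (\<Prod>e\<in>E. x e ^ d e)" for d :: "'e \<Rightarrow> nat"
  define deg where "deg d = (\<Sum>e\<in>E. d e)" for d :: "'e \<Rightarrow> nat"
  define nxt where "nxt e d = d(e := (d e + 1) mod N)" for e and d :: "'e \<Rightarrow> nat"
  define k where "k e d = (if d e + 1 = N then x e ^ N else 1)" for e and d :: "'e \<Rightarrow> nat"
  \<comment> \<open>Different \<open>e\<close> may lead to the same \<open>d'\<close>, as all do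
    when \<open>N = 1\<close>, so their coefficients are added up.\<close>
  define a where "a d d' = (\<Sum>e\<in>E. if d' = nxt e d then c e * k e d else 0)" for d d'
  \<comment> \<open>All exponents 0: this is the generator 1 that \<open>determinant_trick\<close>
    asks for.\<close>
  define d0 where "d0 = (\<lambda>e\<in>E. 0::nat)"
  have finD: "finite D" unfolding D_def using E by (intro finite_PiE) auto
  have nxtD: "nxt e d \<in> D" if "e \<in> E" "d \<in> D" for e d
    using that N unfolding D_def nxt_def by (auto simp: PiE_iff extensional_def)
  have step: "x e * g d = k e d * g (nxt e d)
      \<and> deg (nxt e d) \<le> deg d + 1 \<and> k e d \<in> ideal_pow L (deg d + 1 - deg (nxt e d))"
    if e: "e \<in> E" and d: "d \<in> D" for e d
  proof -
    have de: "d e < N" using e d unfolding D_def by auto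
    have g1: "g d' = x e ^ d' e * (\<Prod>i\<in>E - {e}. x i ^ d' i)" for d'
      unfolding g_def using E e by (simp add: prod.remove)
    have d1: "deg d' = d' e + (\<Sum>i\<in>E - {e}. d' i)" for d'
      unfolding deg_def using E e by (simp add: sum.remove)
    have P: "(\<Prod>i\<in>E - {e}. x i ^ nxt e d i) = (\<Prod>i\<in>E - {e}. x i ^ d i)"
      by (intro prod.cong) (auto simp: nxt_def)
    have S: "(\<Sum>i\<in>E - {e}. nxt e d i) = (\<Sum>i\<in>E - {e}. d i)"
      by (intro sum.cong) (auto simp: nxt_def)
    show ?thesis
    proof (cases "d e + 1 = N")
      case True
      then have "nxt e d e = 0" by (simp add: nxt_def)
      moreover have "x e * x e ^ d e = x e ^ N" using True by (metis Suc_eq_plus1 power_Suc)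
      ultimately show ?thesis
        using True pow[OF e] unfolding g1 d1 P S k_def
        by (auto simp: mult.assoc[symmetric])
    next
      case False
      then have "nxt e d e = d e + 1" using de by (simp add: nxt_def)
      then show ?thesis
        using False unfolding g1 d1 P S k_def by (simp add: mult.assoc)
    qed
  qed
  let ?f = "\<Sum>e\<in>E. c e * x e"
  have rel: "?f * g d = (\<Sum>d'\<in>D. a d d' * g d')" if d: "d \<in> D" for d
  proof -
    have "(\<Sum>d'\<in>D. a d d' * g d') = (\<Sum>d'\<in>D. \<Sum>e\<in>E. if d' = nxt e d then c e * k e d * g d' else 0)"
      unfolding a_def sum_distrib_right by (intro sum.cong refl) auto
    also have "\<dots> = (\<Sum>e\<in>E. \<Sum>d'\<in>D. if d' = nxt e d then c e * k e d * g d' else 0)"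
      by (rule sum.swap)
    also have "\<dots> = (\<Sum>e\<in>E. c e * k e d * g (nxt e d))"
      using finD nxtD d by (intro sum.cong) auto
    also have "\<dots> = (\<Sum>e\<in>E. c e * x e * g d)"
      using step d by (intro sum.cong) (auto simp: mult.assoc)
    finally show ?thesis by (simp add: sum_distrib_right)
  qed
  have mem: "a d d' \<in> ideal_pow L (deg d + 1 - deg d')" if "d \<in> D" for d d'
    unfolding a_def
    by (intro is_ideal_sum[OF is_ideal_ideal_pow])
      (use step that in \<open>auto intro!: is_idealD(1,3)[OF is_ideal_ideal_pow]\<close>)
  have zero: "a d d' = 0" if "d \<in> D" "deg d + 1 < deg d'" for d d'
    unfolding a_def using step that by (intro sum.neutral) fastforce
  obtain h where h: "bij_betw h {0..<card D} D" using ex_bij_betw_nat_finite[OF finD] by blast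
  have hD: "h i \<in> D" if "i < card D" for i using h that by (auto simp: bij_betw_def)
  have "d0 \<in> D" using N by (auto simp: D_def d0_def)
  then have "d0 \<in> h ` {0..<card D}" using bij_betw_imp_surj_on[OF h] by simp
  then obtain i0 where i0: "i0 < card D" "h i0 = d0" by auto
  have g0: "g (h i0) = 1" using i0 by (simp add: g_def d0_def)
  show ?thesis
  proof (rule determinant_trick[of i0 "card D" "\<lambda>i. g (h i)" _ "\<lambda>i j. a (h i) (h j)" "\<lambda>i. deg (h i)"])
    fix i assume i: "i < card D"
    show "?f * g (h i) = (\<Sum>j<card D. a (h i) (h j) * g (h j))"
      using rel[OF hD[OF i]] sum.reindex_bij_betw[OF h, of "\<lambda>d'. a (h i) d' * g d'"]
      by (simp add: atLeast0LessThan)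
  qed (use i0 g0 mem zero hD in auto)
qed

subsection \<open>Rational linear programming\<close>

text \<open>Bartl's inductive proof: a point \<open>x1\<close> that violates the conclusion but satisfies all
  constraints except the last one is used to project onto the kernel of the last functional.\<close>

lemma farkas:
  fixes a :: "'j \<Rightarrow> 'i::finite \<Rightarrow> 'f::linordered_field"
  assumes "finite A"
    and "\<And>x. (\<And>j. j \<in> A \<Longrightarrow> (\<Sum>i\<in>UNIV. a j i * x i) \<le> 0) \<Longrightarrow> (\<Sum>i\<in>UNIV. c i * x i) \<le> 0"
  shows "\<exists>l. (\<forall>j\<in>A. 0 \<le> l j) \<and> (\<forall>i. c i = (\<Sum>j\<in>A. l j * a j i))"
  using assms
proof (induction A arbitrary: a c rule: finite_induct)
  case empty
  have "c k = 0" for k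
  proof -
    \<comment> \<open>Without constraints, \<open>c\<close> can be tested against both signs of a
      unit vector.\<close>
    have "(\<Sum>i\<in>UNIV. c i * (if i = k then 1 else 0)) \<le> 0"
      "(\<Sum>i\<in>UNIV. c i * (if i = k then - 1 else 0)) \<le> 0"
      by (rule empty.prems; simp)+
    then show ?thesis by (simp add: if_distrib cong: if_cong)
  qed
  then show ?case by simp
next
  case (insert m A)
  define dot where "dot u x = (\<Sum>i\<in>UNIV. u i * x i)" for u x :: "'i \<Rightarrow> 'f"
  have dot_diff: "dot u (\<lambda>i. x i - s * y i) = dot u x - s * dot u y" for u x s y
    unfolding dot_def sum_distrib_left sum_subtractf[symmetric]
    by (intro sum.cong) (auto simp: algebra_simps)
  have dot_diff': "dot (\<lambda>i. u i - s * y i) x = dot u x - s * dot y x" for u x s y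
    unfolding dot_def sum_distrib_left sum_subtractf[symmetric]
    by (intro sum.cong) (auto simp: algebra_simps)
  have dot_div: "dot u (\<lambda>i. x i / s) = dot u x / s" for u x s
    unfolding dot_def sum_divide_distrib by (intro sum.cong) auto
  note prem = insert.prems[folded dot_def]
  show ?case
  proof (cases "\<forall>x. (\<forall>j\<in>A. dot (a j) x \<le> 0) \<longrightarrow> dot c x \<le> 0")
    case True
    then obtain l where l: "\<forall>j\<in>A. 0 \<le> l j" "\<forall>i. c i = (\<Sum>j\<in>A. l j * a j i)"
      using insert.IH[of a c, folded dot_def] by blast
    have "(\<Sum>j\<in>A. (l(m := 0)) j * a j i) = (\<Sum>j\<in>A. l j * a j i)" for i
      using insert.hyps by (intro sum.cong) auto
    then show ?thesis
      using l insert.hyps by (intro exI[of _ "l(m := 0)"]) auto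
  next
    case False
    then obtain x1 where x1: "\<forall>j\<in>A. dot (a j) x1 \<le> 0" "dot c x1 > 0" by fastforce
    have am: "dot (a m) x1 > 0"
    proof (rule ccontr)
      assume "\<not> 0 < dot (a m) x1"
      then have "dot c x1 \<le> 0" using x1(1) by (intro prem) auto
      then show False using x1(2) by simp
    qed
    define x0 where "x0 i = x1 i / dot (a m) x1" for i
    have x0: "dot (a m) x0 = 1" "\<forall>j\<in>A. dot (a j) x0 \<le> 0" "dot c x0 > 0"
      using x1 am unfolding x0_def dot_div by (auto simp: divide_nonpos_pos)
    \<comment> \<open>\<open>a' j\<close> and \<open>c'\<close> are \<open>a j\<close> and
      \<open>c\<close> composed with the projection taking \<open>x\<close> to
      \<open>x - dot (a m) x * x0\<close>, which lands in the kernel of \<open>a m\<close> because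
      \<open>dot (a m) x0 = 1\<close>.\<close>
    define a' where "a' j i = a j i - dot (a j) x0 * a m i" for j i
    define c' where "c' i = c i - dot c x0 * a m i" for i
    have "\<exists>l. (\<forall>j\<in>A. 0 \<le> l j) \<and> (\<forall>i. c' i = (\<Sum>j\<in>A. l j * a' j i))"
    proof (rule insert.IH[of a' c', folded dot_def])
      fix x assume x: "\<And>j. j \<in> A \<Longrightarrow> dot (a' j) x \<le> 0"
      let ?z = "\<lambda>i. x i - dot (a m) x * x0 i"
      have "dot c ?z \<le> 0"
      proof (rule prem)
        fix j assume "j \<in> insert m A"
        then show "dot (a j) ?z \<le> 0"
          using x x0(1) unfolding dot_diff a'_def dot_diff' by (auto simp: mult.commute)
      qed
      then show "dot c' x \<le> 0"
        unfolding dot_diff c'_def dot_diff' by (simp add: mult.commute)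
    qed
    then obtain l where l: "\<forall>j\<in>A. 0 \<le> l j" "\<forall>i. c' i = (\<Sum>j\<in>A. l j * a' j i)" by blast
    \<comment> \<open>Undoing the projection leaves this multiple of \<open>a m\<close>. It is
      nonnegative because \<open>x0\<close> is positive on \<open>c\<close> and nonpositive on every
      \<open>a j\<close> with \<open>j \<in> A\<close>.\<close>
    define s where "s = dot c x0 - (\<Sum>j\<in>A. l j * dot (a j) x0)"
    have "(\<Sum>j\<in>A. l j * dot (a j) x0) \<le> 0"
      using l x0 by (intro sum_nonpos) (auto intro: mult_nonneg_nonpos)
    then have s: "0 \<le> s" using x0(3) by (simp add: s_def)
    have "c i = (\<Sum>j\<in>insert m A. (l(m := s)) j * a j i)" for i
    proof -
      have "c i = c' i + dot c x0 * a m i" by (simp add: c'_def)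
      also have "c' i = (\<Sum>j\<in>A. l j * a j i - l j * dot (a j) x0 * a m i)"
        unfolding l(2)[rule_format] by (intro sum.cong) (auto simp: a'_def algebra_simps)
      also have "\<dots> = (\<Sum>j\<in>A. l j * a j i) - (\<Sum>j\<in>A. l j * dot (a j) x0) * a m i"
        by (simp add: sum_subtractf sum_distrib_right)
      also have "(\<Sum>j\<in>A. l j * a j i) = (\<Sum>j\<in>A. (l(m := s)) j * a j i)"
        using insert.hyps by (intro sum.cong) auto
      finally show ?thesis using insert.hyps by (simp add: s_def algebra_simps)
    qed
    then show ?thesis
      using l s insert.hyps by (intro exI[of _ "l(m := s)"]) auto
  qed
qed

section \<open>Integral combinations from rational multipliers\<close>

lemma common_denominator:
  fixes y :: "'j \<Rightarrow> rat"
  assumes "finite G" "\<And>j. j \<in> G \<Longrightarrow> 0 \<le> y j"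
  shows "\<exists>N\<ge>1. \<exists>m. \<forall>j\<in>G. of_nat N * y j = of_nat (m j)"
  using assms
proof (induction G rule: finite_induct)
  case (insert x G)
  then obtain N m where N: "N \<ge> 1" "\<forall>j\<in>G. of_nat N * y j = of_nat (m j)" by auto
  obtain p q where pq: "quotient_of (y x) = (p, q)" by (cases "quotient_of (y x)")
  have q: "q > 0" using quotient_of_denom_pos[OF pq] .
  have yx: "of_int q * y x = of_int p" using quotient_of_div[OF pq] q by simp
  have "0 \<le> of_int q * y x" using insert.prems q by simp
  then have p: "0 \<le> p" unfolding yx by simp
  define m' where "m' j = (if j = x then N * nat p else nat q * m j)" for j
  have "of_nat (N * nat q) * y j = of_nat (m' j)" if j: "j \<in> insert x G" for j
  proof (cases "j = x")
    case True
    then show ?thesis using yx q p by (simp add: m'_def mult.assoc)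
  next
    case False
    then have "of_nat N * y j = of_nat (m j)" using N j by auto
    then show ?thesis using False q by (simp add: m'_def mult.assoc mult.left_commute)
  qed
  moreover have "N * nat q \<ge> 1" using N q by (simp add: Suc_le_eq)
  ultimately show ?case by blast
qed auto

lemma list_with_multiplicities:
  fixes g :: "'j \<Rightarrow> 'v \<Rightarrow> nat"
  assumes "finite G"
  shows "\<exists>xs. set xs \<subseteq> G \<and> length xs = (\<Sum>j\<in>G. m j)
    \<and> (\<forall>v. (\<Sum>x\<leftarrow>xs. g x v) = (\<Sum>j\<in>G. m j * g j v))"
  using assms
proof (induction G rule: finite_induct)
  case (insert x G)
  then obtain xs where "set xs \<subseteq> G" "length xs = (\<Sum>j\<in>G. m j)"
    "\<forall>v. (\<Sum>x\<leftarrow>xs. g x v) = (\<Sum>j\<in>G. m j * g j v)" by auto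
  then show ?case
    using insert.hyps by (intro exI[of _ "replicate (m x) x @ xs"]) (auto simp: sum_list_replicate)
qed simp

lemma sum_UNIV_option:
  fixes f :: "'v::finite option \<Rightarrow> 'a::comm_monoid_add"
  shows "(\<Sum>i\<in>UNIV. f i) = f None + (\<Sum>v\<in>UNIV. f (Some v))"
proof -
  have "(\<Sum>i\<in>UNIV. f i) = f None + (\<Sum>i\<in>Some ` UNIV. f i)"
    unfolding UNIV_option_conv by (subst sum.insert) auto
  then show ?thesis by (simp add: sum.reindex)
qed

lemma sum_list_take_le: "(\<Sum>x\<leftarrow>take n xs. f x) \<le> (\<Sum>x\<leftarrow>xs. f x :: nat)"
proof -
  have "(\<Sum>x\<leftarrow>xs. f x) = (\<Sum>x\<leftarrow>take n xs @ drop n xs. f x)" by simp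
  then show ?thesis unfolding map_append sum_list_append by linarith
qed

text \<open>Linear programming duality for columns \<open>G\<close> and bound \<open>e\<close>:
  either a feasible rational point reaches \<open>\<nu>\<close>, and clearing its denominators gives
  \<open>N\<close>, or a dual weight keeps the value below \<open>\<nu>\<close>. It is applied with
  \<open>\<nu> = 1\<close> to integral closures and with the optimal value to
  \<open>nu_star\<close>.\<close>

lemma integral_combination_or_weight:
  fixes g :: "'j \<Rightarrow> 'v::finite \<Rightarrow> nat" and e :: "'v \<Rightarrow> nat" and \<nu> :: nat
  assumes "finite G"
  obtains (combination) N xs where "1 \<le> N" "length xs = N * \<nu>" "set xs \<subseteq> G"
      "\<And>v. (\<Sum>x\<leftarrow>xs. g x v) \<le> N * e v"
  | (weight) w :: "'v \<Rightarrow> rat" and c where "\<And>v. 0 \<le> w v" "0 < c"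
      "\<And>j. j \<in> G \<Longrightarrow> c \<le> (\<Sum>v\<in>UNIV. w v * of_nat (g j v))"
      "(\<Sum>v\<in>UNIV. w v * of_nat (e v)) < of_nat \<nu> * c"
proof -
  \<comment> \<open>The coordinate \<open>None\<close> counts generators. Besides the vectors
    \<open>(g, 1)\<close> there are slack vectors: the unit vectors turn equality with
    \<open>b\<close> into a bound by \<open>e\<close> from above, and \<open>- 1\<close> at
    \<open>None\<close> turns it into a bound by \<open>\<nu>\<close> from below.\<close>
  define a :: "'j + 'v option \<Rightarrow> 'v option \<Rightarrow> rat" where
    "a j i = (case (j, i) of
        (Inl g', Some v) \<Rightarrow> of_nat (g g' v) | (Inl g', None) \<Rightarrow> 1
      | (Inr (Some u), Some v) \<Rightarrow> (if v = u then 1 else 0) | (Inr (Some u), None) \<Rightarrow> 0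
      | (Inr None, Some v) \<Rightarrow> 0 | (Inr None, None) \<Rightarrow> - 1)" for j i
  define b :: "'v option \<Rightarrow> rat" where
    "b i = (case i of Some v \<Rightarrow> of_nat (e v) | None \<Rightarrow> of_nat \<nu>)" for i
  have finA: "finite (G <+> (UNIV :: 'v option set))" using assms by simp
  show ?thesis
  proof (cases "\<forall>x. (\<forall>j\<in>G <+> UNIV. (\<Sum>i\<in>UNIV. a j i * x i) \<le> 0) \<longrightarrow> (\<Sum>i\<in>UNIV. b i * x i) \<le> 0")
    case False
    then obtain x where x: "\<And>j. j \<in> G <+> UNIV \<Longrightarrow> (\<Sum>i\<in>UNIV. a j i * x i) \<le> 0"
      "(\<Sum>i\<in>UNIV. b i * x i) > 0" by fastforce
    \<comment> \<open>Up to sign, the separating \<open>x\<close> is the weight; the slack vectors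
      make it nonnegative, and \<open>x None\<close> becomes \<open>c\<close>.\<close>
    have xv: "x (Some v) \<le> 0" for v
    proof -
      have "(\<Sum>i\<in>UNIV. a (Inr (Some v)) i * x i) = 
          (\<Sum>u\<in>UNIV. (if u = v then 1 else 0) * x (Some u))"
        unfolding sum_UNIV_option by (simp add: a_def)
      also have "\<dots> = (\<Sum>u\<in>UNIV. if u = v then x (Some u) else 0)"
        by (intro sum.cong) auto
      finally show ?thesis using x(1)[OF InrI[OF UNIV_I], of "Some v"] by simp
    qed
    have xg: "x None \<le> (\<Sum>v\<in>UNIV. - x (Some v) * of_nat (g j v))" if "j \<in> G" for j
      using x(1)[OF InlI[OF that]] unfolding sum_UNIV_option
      by (simp add: a_def sum_negf mult.commute)
    have xe: "(\<Sum>v\<in>UNIV. - x (Some v) * of_nat (e v)) < of_nat \<nu> * x None"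
      using x(2) unfolding sum_UNIV_option by (simp add: b_def sum_negf mult.commute)
    have "0 \<le> (\<Sum>v\<in>UNIV. - x (Some v) * of_nat (e v))"
      using xv by (intro sum_nonneg mult_nonneg_nonneg) auto
    then have "0 < of_nat \<nu> * x None" using xe by linarith
    then have "0 < x None" by (simp add: zero_less_mult_iff)
    then show ?thesis using weight[of "\<lambda>v. - x (Some v)" "x None"] xv xg xe by auto
  next
    case True
    then have "\<exists>l. (\<forall>j\<in>G <+> UNIV. 0 \<le> l j) \<and> (\<forall>i. b i = (\<Sum>j\<in>G <+> UNIV. l j * a j i))"
      by (intro farkas[OF finA]) blast
    then obtain l where l: "\<forall>j\<in>G <+> UNIV. 0 \<le> l j"
      "\<And>i. b i = (\<Sum>j\<in>G <+> UNIV. l j * a j i)" by blast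
    have b2: "b i = (\<Sum>j\<in>G. l (Inl j) * a (Inl j) i) +
        (l (Inr None) * a (Inr None) i + (\<Sum>u\<in>UNIV. l (Inr (Some u)) * a (Inr (Some u)) i))" for i
      unfolding l(2) using assms by (subst sum.Plus) (auto simp: sum_UNIV_option)
    have l0: "0 \<le> l (Inl j)" if "j \<in> G" for j using l(1) that by (blast intro: InlI)
    have l1: "0 \<le> l (Inr j)" for j using l(1) by (blast intro: InrI)
    have deg: "of_nat \<nu> \<le> (\<Sum>j\<in>G. l (Inl j))"
      using b2[of None] l1[of None] by (simp add: b_def a_def)
    have le: "(\<Sum>j\<in>G. l (Inl j) * of_nat (g j v)) \<le> of_nat (e v)" for v
    proof -
      have "(\<Sum>u\<in>UNIV. l (Inr (Some u)) * a (Inr (Some u)) (Some v)) \<ge> 0"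
        using l1 by (intro sum_nonneg mult_nonneg_nonneg) (auto simp: a_def)
      then show ?thesis using b2[of "Some v"] by (simp add: b_def a_def)
    qed
    obtain N m where N: "N \<ge> 1" "\<forall>j\<in>G. of_nat N * l (Inl j) = of_nat (m j)"
      using common_denominator[of G "\<lambda>j. l (Inl j)"] assms l0 by auto
    obtain xs where xs: "set xs \<subseteq> G" "length xs = (\<Sum>j\<in>G. m j)"
      "\<forall>v. (\<Sum>x\<leftarrow>xs. g x v) = (\<Sum>j\<in>G. m j * g j v)"
      using list_with_multiplicities[OF assms] by blast
    have "of_nat (N * \<nu>) \<le> of_nat N * (\<Sum>j\<in>G. l (Inl j))"
      using deg N by simp
    also have "\<dots> = (\<Sum>j\<in>G. of_nat (m j))"
      unfolding sum_distrib_left using N by (intro sum.cong) auto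
    also have "\<dots> = of_nat (length xs)" using xs by simp
    finally have len: "N * \<nu> \<le> length xs" by (simp only: of_nat_le_iff)
    have "(\<Sum>x\<leftarrow>xs. g x v) \<le> N * e v" for v
    proof -
      have "(of_nat (\<Sum>x\<leftarrow>xs. g x v) :: rat) = (\<Sum>j\<in>G. of_nat N * l (Inl j) * of_nat (g j v))"
        using xs(3) N by simp
      also have "\<dots> = of_nat N * (\<Sum>j\<in>G. l (Inl j) * of_nat (g j v))"
        by (simp add: sum_distrib_left mult.assoc)
      also have "\<dots> \<le> of_nat N * of_nat (e v)" using le by (intro mult_left_mono) auto
      finally have "(of_nat (\<Sum>x\<leftarrow>xs. g x v) :: rat) \<le> of_nat (N * e v)" by simp
      then show ?thesis by (simp only: of_nat_le_iff)
    qed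
    \<comment> \<open>The list may be longer than \<open>N * \<nu>\<close>; cutting it off preserves
      the upper bounds.\<close>
    then have "(\<Sum>x\<leftarrow>take (N * \<nu>) xs. g x v) \<le> N * e v" for v
      using sum_list_take_le order_trans by blast
    then show ?thesis
      using combination[of N "take (N * \<nu>) xs"] N(1) len xs(1) set_take_subset[of "N * \<nu>" xs] by auto
  qed
qed

subsection \<open>Dickson's lemma\<close>

text \<open>Every sequence has a monotone subsequence, and a decreasing one in the naturals is
  constant from where it attains its minimum.\<close>

lemma nat_incseq_subseq:
  fixes s :: "nat \<Rightarrow> nat"
  shows "\<exists>r. strict_mono r \<and> incseq (\<lambda>n. s (r n))"
proof -
  obtain f where f: "strict_mono f" "monoseq (\<lambda>n. s (f n))"
    using seq_monosub[of s] by auto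
  show ?thesis
  proof (cases "incseq (\<lambda>n. s (f n))")
    case False
    then have dec: "decseq (\<lambda>n. s (f n))" using f(2) by (simp add: monoseq_iff)
    define m where "m = (LEAST k. k \<in> range (\<lambda>n. s (f n)))"
    have "m \<in> range (\<lambda>n. s (f n))" unfolding m_def by (rule LeastI) auto
    then obtain n0 where n0: "m = s (f n0)" by blast
    have "s (f (n0 + n)) = m" for n
    proof (rule antisym)
      show "s (f (n0 + n)) \<le> m" using decseqD[OF dec, of n0 "n0 + n"] n0 by simp
      show "m \<le> s (f (n0 + n))" unfolding m_def by (rule Least_le) auto
    qed
    moreover have "strict_mono (\<lambda>n. f (n0 + n))" using f(1) by (simp add: strict_mono_def)
    ultimately show ?thesis by (intro exI[of _ "\<lambda>n. f (n0 + n)"]) (simp add: incseq_def)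
  qed (use f in auto)
qed

text \<open>Subsequences are extracted one coordinate after another; monotonicity in earlier
  coordinates survives further extraction.\<close>

lemma incseq_subseq_coordinates:
  fixes s :: "nat \<Rightarrow> 'v \<Rightarrow> nat"
  assumes "finite F"
  shows "\<exists>r. strict_mono r \<and> (\<forall>v\<in>F. incseq (\<lambda>n. s (r n) v))"
  using assms
proof (induction F rule: finite_induct)
  case empty
  then show ?case by (intro exI[of _ id]) (auto simp: strict_mono_def)
next
  case (insert u F)
  then obtain r where r: "strict_mono r" "\<forall>v\<in>F. incseq (\<lambda>n. s (r n) v)" by blast
  obtain q where q: "strict_mono q" "incseq (\<lambda>n. s (r (q n)) u)"
    using nat_incseq_subseq[of "\<lambda>n. s (r n) u"] by blast
  have "incseq (\<lambda>n. s (r (q n)) v)" if "v \<in> F" for v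
    using r(2) that q(1) unfolding incseq_def by (meson strict_mono_less_eq)
  moreover have "strict_mono (\<lambda>n. r (q n))" using r q by (simp add: strict_mono_def)
  ultimately show ?case using q by (intro exI[of _ "\<lambda>n. r (q n)"]) auto
qed

definition min_exps :: "('v \<Rightarrow>\<^sub>0 nat) set \<Rightarrow> ('v \<Rightarrow>\<^sub>0 nat) set" where
  "min_exps U = {e \<in> U. \<forall>f\<in>U. exp_le f e \<longrightarrow> f = e}"

text \<open>An infinite set would contain an injective sequence with a coordinatewise increasing
  subsequence, hence two distinct comparable elements, against minimality. This makes the linear
  programs finite.\<close>

lemma finite_min_exps:
  fixes U :: "('v::finite \<Rightarrow>\<^sub>0 nat) set"
  shows "finite (min_exps U)"
proof (rule ccontr)
  assume "infinite (min_exps U)"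
  then obtain s :: "nat \<Rightarrow> 'v \<Rightarrow>\<^sub>0 nat" where s: "inj s" "range s \<subseteq> min_exps U"
    using infinite_countable_subset by blast
  obtain r where r: "strict_mono r" "\<forall>v. incseq (\<lambda>n. Poly_Mapping.lookup (s (r n)) v)"
    using incseq_subseq_coordinates[of UNIV "\<lambda>n. Poly_Mapping.lookup (s n)"] by auto
  have "exp_le (s (r 0)) (s (r 1))"
    unfolding exp_le_def using r(2) by (auto simp: incseq_def)
  then have "s (r 0) = s (r 1)" using s(2) unfolding min_exps_def by blast
  then have "r 0 = r 1" using s(1) by (simp add: inj_eq)
  moreover have "r 0 < r 1" using r(1) by (simp add: strict_mono_def)
  ultimately show False by simp
qed

text \<open>Among the elements of \<open>U\<close> below \<open>u\<close>, one of least total degree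
  is minimal.\<close>

lemma ex_min_exps_le:
  fixes U :: "('v::finite \<Rightarrow>\<^sub>0 nat) set"
  assumes "u \<in> U"
  shows "\<exists>g\<in>min_exps U. exp_le g u"
proof -
  let ?d = "\<lambda>e. \<Sum>v\<in>UNIV. Poly_Mapping.lookup e v :: nat"
  obtain g where g: "g \<in> U" "exp_le g u" and least: "\<And>f. f \<in> U \<Longrightarrow> exp_le f u \<Longrightarrow> ?d g \<le> ?d f"
    using ex_has_least_nat[of "\<lambda>e. e \<in> U \<and> exp_le e u" u ?d] assms by (auto simp: exp_le_def)
  have "f = g" if f: "f \<in> U" "exp_le f g" for f
  proof (rule ccontr)
    assume "f \<noteq> g"
    then obtain v where "Poly_Mapping.lookup f v \<noteq> Poly_Mapping.lookup g v"
      by (meson poly_mapping_eqI)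
    then have "?d f < ?d g"
      using f(2) unfolding exp_le_def
      by (intro sum_strict_mono_ex1) (auto intro!: exI[of _ v] simp: order_less_le)
    moreover have "exp_le f u" using f g unfolding exp_le_def by (meson order_trans)
    ultimately show False using least[OF f(1)] by simp
  qed
  then show ?thesis using g unfolding min_exps_def by blast
qed

subsection \<open>Weights on exponents\<close>

definition wt :: "('v::finite \<Rightarrow> rat) \<Rightarrow> ('v \<Rightarrow>\<^sub>0 nat) \<Rightarrow> rat" where
  "wt w e = (\<Sum>v\<in>UNIV. w v * of_nat (Poly_Mapping.lookup e v))"

lemma wt_zero [simp]: "wt w 0 = 0"
  by (simp add: wt_def)

lemma wt_add [simp]: "wt w (e + f) = wt w e + wt w f"
  by (simp add: wt_def lookup_add distrib_left sum.distrib)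

lemma wt_mono_weight: "(\<And>v. w v \<le> w' v) \<Longrightarrow> wt w e \<le> wt w' e"
  unfolding wt_def by (intro sum_mono mult_right_mono) auto

lemma wt_mono: "(\<And>v. 0 \<le> w v) \<Longrightarrow> exp_le e f \<Longrightarrow> wt w e \<le> wt w f"
  unfolding wt_def exp_le_def by (intro sum_mono mult_left_mono) auto

text \<open>Perturb the weights by distinct powers of a small \<open>t\<close>: two exponents get the same weight
  only for \<open>t\<close> among the finitely many roots of a nonzero polynomial.\<close>

lemma generic_weight:
  fixes w :: "'v::finite \<Rightarrow> rat"
  assumes "finite E" "wt w e0 < c"
  shows "\<exists>w'. (\<forall>v. w v \<le> w' v) \<and> wt w' e0 < c \<and> inj_on (wt w') E"
proof -
  obtain idx :: "'v \<Rightarrow> nat" where idx: "inj idx"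
    using finite_imp_inj_to_nat_seg[of "UNIV :: 'v set"] by auto
  define wp where "wp t v = w v + t ^ (idx v + 1)" for t v
  \<comment> \<open>The weight difference of \<open>e\<close> and \<open>f\<close> as a polynomial
    in the perturbation \<open>t\<close>. The shift by 1 keeps the constant term apart, and
    injectivity of \<open>idx\<close> makes the coefficient at \<open>idx v + 1\<close> a single
    difference of exponents.\<close>
  define p where "p e f = [:wt w e - wt w f:] + (\<Sum>v\<in>UNIV. Polynomial.monom
      (of_nat (Poly_Mapping.lookup e v) - of_nat (Poly_Mapping.lookup f v)) (idx v + 1))"
    for e f :: "'v \<Rightarrow>\<^sub>0 nat"
  have wt_wp: "wt (wp t) e = wt w e + (\<Sum>v\<in>UNIV. t ^ (idx v + 1) * of_nat (Poly_Mapping.lookup e v))"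
    for t e
    by (simp add: wt_def wp_def distrib_right sum.distrib)
  have poly_p: "poly (p e f) t = wt (wp t) e - wt (wp t) f" for e f t
    unfolding wt_wp p_def
    by (simp add: poly_sum poly_monom algebra_simps sum_subtractf)
  have p_nz: "p e f \<noteq> 0" if ne: "e \<noteq> f" for e f
  proof -
    obtain v where v: "Poly_Mapping.lookup e v \<noteq> Poly_Mapping.lookup f v"
      using ne by (meson poly_mapping_eqI)
    have "coeff (p e f) (idx v + 1) = (\<Sum>u\<in>UNIV. if u = v then
        of_nat (Poly_Mapping.lookup e u) - of_nat (Poly_Mapping.lookup f u) else 0)"
      unfolding p_def using idx
      by (auto simp: coeff_sum inj_eq intro!: sum.cong)
    also have "\<dots> \<noteq> 0" using v by simp
    finally show ?thesis by auto
  qed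
  define bad where "bad = (\<Union>e\<in>E. \<Union>f\<in>E - {e}. {t. poly (p e f) t = 0})"
  have "finite bad"
    unfolding bad_def using assms(1) p_nz by (intro finite_UN_I) (auto intro!: poly_roots_finite)
  define K where "K = (\<Sum>v\<in>UNIV. of_nat (Poly_Mapping.lookup e0 v) :: rat)"
  have K: "0 \<le> K" unfolding K_def by (intro sum_nonneg) auto
  \<comment> \<open>For \<open>t < 1\<close> the perturbation raises the weight of \<open>e0\<close>
    by at most \<open>t * K\<close>, which this bound keeps below the gap
    \<open>c - wt w e0\<close>; \<open>K + 1\<close> avoids a division by zero.\<close>
  define d where "d = min 1 ((c - wt w e0) / (K + 1))"
  have "0 < d" using assms(2) K by (simp add: d_def)
  then have "infinite ({0<..<d} - bad)"
    using \<open>finite bad\<close> infinite_Ioo Diff_infinite_finite by blast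
  then obtain t where t: "0 < t" "t < d" "t \<notin> bad"
    by (metis Diff_iff finite.emptyI equals0I greaterThanLessThan_iff)
  have t1: "t < 1" and tK: "t * (K + 1) < c - wt w e0"
    using t K by (auto simp: d_def pos_less_divide_eq)
  have "(\<Sum>v\<in>UNIV. t ^ (idx v + 1) * of_nat (Poly_Mapping.lookup e0 v)) \<le> t * K"
    unfolding K_def sum_distrib_left
  proof (intro sum_mono mult_right_mono)
    fix v
    show "t ^ (idx v + 1) \<le> t" using power_decreasing[of 1 "idx v + 1" t] t t1 by simp
  qed auto
  then have "wt (wp t) e0 < c" unfolding wt_wp using tK t by (simp add: algebra_simps)
  moreover have "inj_on (wt (wp t)) E"
  proof (rule inj_onI, rule ccontr)
    fix e f assume ef: "e \<in> E" "f \<in> E" "wt (wp t) e = wt (wp t) f" "e \<noteq> f"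
    then have "t \<in> bad" unfolding bad_def using poly_p[of e f t] by auto
    then show False using t by simp
  qed
  moreover have "w v \<le> wp t v" for v using t by (simp add: wp_def)
  ultimately show ?thesis by blast
qed

subsection \<open>Monomial ideals\<close>

definition mono_span :: "('v \<Rightarrow>\<^sub>0 nat) set \<Rightarrow> ('v, 'k::comm_ring_1) mpoly set" where
  "mono_span U = {p. Poly_Mapping.keys p \<subseteq> U}"

definition upset :: "('v \<Rightarrow>\<^sub>0 nat) set \<Rightarrow> bool" where
  "upset U \<longleftrightarrow> (\<forall>e\<in>U. \<forall>f. exp_le e f \<longrightarrow> f \<in> U)"

lemma exp_le_refl [simp]: "exp_le e e"
  and exp_le_add: "exp_le e (f + e)" "exp_le e (e + f)"
  and exp_le_trans: "exp_le e f \<Longrightarrow> exp_le f g \<Longrightarrow> exp_le e g"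
  by (auto simp: exp_le_def lookup_add intro: order_trans)

lemma exp_le_add_diff: "exp_le e f \<Longrightarrow> e + (f - e) = f"
  by (intro poly_mapping_eqI) (simp add: lookup_add lookup_minus exp_le_def)

lemma upset_add: "upset U \<Longrightarrow> e \<in> U \<Longrightarrow> f + e \<in> U"
  unfolding upset_def using exp_le_add by blast

lemma upset_Int: "upset U \<Longrightarrow> upset V \<Longrightarrow> upset (U \<inter> V)"
  unfolding upset_def by blast

lemma mono_span_mult:
  assumes "p \<in> mono_span U" "q \<in> mono_span V" "\<And>a b. a \<in> U \<Longrightarrow> b \<in> V \<Longrightarrow> a + b \<in> W"
  shows "p * q \<in> mono_span W"
  using assms keys_mult[of p q] unfolding mono_span_def by blast

lemma mono_span_add: "p \<in> mono_span U \<Longrightarrow> q \<in> mono_span U \<Longrightarrow> p + q \<in> mono_span U"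
  using keys_add[of p q] unfolding mono_span_def by blast

lemma mono_span_UNIV [simp]: "mono_span UNIV = UNIV"
  by (simp add: mono_span_def)

lemma single_mem_mono_span [intro]: "e \<in> U \<Longrightarrow> Poly_Mapping.single e c \<in> mono_span U"
  by (auto simp: mono_span_def)

lemma monom_mem_mono_span [simp]: "Defs.monom e \<in> (mono_span U :: ('v, 'k::comm_ring_1) mpoly set) \<longleftrightarrow> e \<in> U"
  by (simp add: mono_span_def Defs.monom_def)

lemma is_ideal_mono_span:
  assumes "upset U"
  shows "is_ideal (mono_span U)"
  unfolding is_ideal_def
proof (intro conjI ballI allI impI)
  show "0 \<in> mono_span U" by (simp add: mono_span_def)
next
  fix r a :: "('a, 'b) mpoly" assume "a \<in> mono_span U"
  then show "r * a \<in> mono_span U"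
    using mono_span_mult[of r UNIV a U U] upset_add[OF assms] by simp
qed (rule mono_span_add)

lemma sum_singles_keys: "p = (\<Sum>e\<in>Poly_Mapping.keys p. Poly_Mapping.single e (Poly_Mapping.lookup p e))"
proof (rule poly_mapping_eqI)
  fix k
  have "(\<Sum>e\<in>Poly_Mapping.keys p. Poly_Mapping.lookup (Poly_Mapping.single e (Poly_Mapping.lookup p e)) k)
      = (\<Sum>e\<in>Poly_Mapping.keys p. if e = k then Poly_Mapping.lookup p e else 0)"
    by (intro sum.cong) (auto simp: lookup_single)
  also have "\<dots> = Poly_Mapping.lookup p k" by (simp add: in_keys_iff)
  finally show "Poly_Mapping.lookup p k = Poly_Mapping.lookup
      (\<Sum>e\<in>Poly_Mapping.keys p. Poly_Mapping.single e (Poly_Mapping.lookup p e)) k"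
    by (simp add: lookup_sum)
qed

lemma single_eq_mult_monom: "Poly_Mapping.single e c = Poly_Mapping.single 0 c * Defs.monom e"
  by (simp add: Defs.monom_def mult_single)

lemma mono_span_subset_ideal:
  fixes K :: "('v, 'k::comm_ring_1) mpoly set"
  assumes "is_ideal K" "\<And>e. e \<in> U \<Longrightarrow> Defs.monom e \<in> K"
  shows "mono_span U \<subseteq> K"
proof
  fix p :: "('v, 'k) mpoly" assume "p \<in> mono_span U"
  then have "Poly_Mapping.single e (Poly_Mapping.lookup p e) \<in> K" if "e \<in> Poly_Mapping.keys p" for e
    using assms that unfolding single_eq_mult_monom[of e]
    by (intro is_idealD(3)) (auto simp: mono_span_def)
  then show "p \<in> K" by (subst sum_singles_keys) (rule is_ideal_sum[OF assms(1)])
qed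

text \<open>The sums, products and extensions of ideals below are identified this way: the
  generators bound the ideal from above, the monomials from below.\<close>

lemma ideal_of_eq_mono_span:
  assumes "upset U" "X \<subseteq> mono_span U" "\<And>e. e \<in> U \<Longrightarrow> Defs.monom e \<in> ideal_of X"
  shows "ideal_of X = mono_span U"
  using assms ideal_of_subset[OF is_ideal_mono_span] mono_span_subset_ideal[OF is_ideal_ideal_of]
  by blast

lemma monomial_ideal_eq_mono_span:
  assumes "monomial_ideal I"
  obtains U where "upset U" "I = mono_span U"
proof -
  obtain G where G: "I = ideal_of (Defs.monom ` G)" using assms unfolding monomial_ideal_def by blast
  let ?U = "{e. \<exists>g\<in>G. exp_le g e}"
  have U: "upset ?U" unfolding upset_def using exp_le_trans by blast
  have "I = mono_span ?U"
    unfolding G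
  proof (rule ideal_of_eq_mono_span[OF U])
    show "Defs.monom ` G \<subseteq> mono_span ?U" by (fastforce intro: exp_le_refl)
    fix e assume "e \<in> ?U"
    then obtain g where g: "g \<in> G" "exp_le g e" by blast
    then have "Defs.monom (e - g) * Defs.monom g = (Defs.monom e :: ('a, 'b) mpoly)"
      using exp_le_add_diff[of g e] by (simp add: Defs.monom_def mult_single add.commute)
    moreover have "Defs.monom g \<in> ideal_of (Defs.monom ` G)" using g subset_ideal_of by blast
    ultimately show "Defs.monom e \<in> ideal_of (Defs.monom ` G :: ('a, 'b) mpoly set)"
      using is_idealD(3)[OF is_ideal_ideal_of] by metis
  qed
  then show ?thesis using that U by blast
qed

lemma ideal_prod_mono_span:
  assumes "upset U"
  shows "ideal_prod (mono_span U) (mono_span V) =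
    (mono_span {a + b | a b. a \<in> U \<and> b \<in> V} :: ('v, 'k::comm_ring_1) mpoly set)"
  unfolding ideal_prod_def
proof (rule ideal_of_eq_mono_span)
  show "upset {a + b |a b. a \<in> U \<and> b \<in> V}"
    unfolding upset_def
  proof (intro ballI allI impI)
    fix e f assume "e \<in> {a + b |a b. a \<in> U \<and> b \<in> V}" and le: "exp_le e f"
    then obtain a b where ab: "e = a + b" "a \<in> U" "b \<in> V" by blast
    \<comment> \<open>The excess \<open>f - e\<close> goes to the summand from the up-closed set
      \<open>U\<close>.\<close>
    have "f = ((f - e) + a) + b"
      using exp_le_add_diff[OF le] by (simp add: ab(1) add_ac)
    then show "f \<in> {a + b |a b. a \<in> U \<and> b \<in> V}" using ab upset_add[OF assms] by blast
  qed
  show "{a * b |a b. a \<in> mono_span U \<and> b \<in> mono_span V} \<subseteq>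
      (mono_span {a + b |a b. a \<in> U \<and> b \<in> V} :: ('v, 'k) mpoly set)"
    using mono_span_mult[of _ U _ V "{a + b |a b. a \<in> U \<and> b \<in> V}"] by blast
  fix e assume "e \<in> {a + b |a b. a \<in> U \<and> b \<in> V}"
  then obtain a b where ab: "e = a + b" "a \<in> U" "b \<in> V" by blast
  have "(Defs.monom e :: ('v, 'k) mpoly) = Defs.monom a * Defs.monom b"
    by (simp add: ab Defs.monom_def mult_single)
  moreover have "Defs.monom a * Defs.monom b \<in>
      {a * b |a b. a \<in> mono_span U \<and> b \<in> (mono_span V :: ('v, 'k) mpoly set)}"
    using ab monom_mem_mono_span by blast
  ultimately show "(Defs.monom e :: ('v, 'k) mpoly) \<in>
      ideal_of {a * b |a b. a \<in> mono_span U \<and> b \<in> mono_span V}"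
    using subset_ideal_of by (metis (no_types, lifting) in_mono)
qed

text \<open>An integral equation for \<open>f\<close> is contradicted at the lowest monomial of \<open>f ^ n\<close> with
  respect to a generic weight in which \<open>f\<close> starts lower than \<open>L\<close>.\<close>

lemma int_closure_wt_le:
  fixes f :: "('v::finite, 'k::field) mpoly"
  assumes w: "\<And>v. 0 \<le> w v" and L: "L \<subseteq> mono_span {e. c \<le> wt w e}"
    and f: "f \<in> int_closure L" and e0: "e0 \<in> Poly_Mapping.keys f"
  shows "c \<le> wt w e0"
proof (rule ccontr)
  assume "\<not> c \<le> wt w e0"
  then obtain w' where w': "\<And>v. w v \<le> w' v" "wt w' e0 < c" "inj_on (wt w') (Poly_Mapping.keys f)"
    using generic_weight[of "Poly_Mapping.keys f" w e0 c] by auto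
  have w'0: "0 \<le> w' v" for v using w[of v] w'(1)[of v] by linarith
  \<comment> \<open>\<open>Ge\<close> and \<open>Gt\<close> filter the ring by the order of
    vanishing along \<open>w'\<close>. As \<open>w'\<close> dominates \<open>w\<close>, the ideal
    \<open>L\<close> stays in \<open>Ge c\<close>.\<close>
  define Ge where "Ge s = (mono_span {e. s \<le> wt w' e} :: ('v, 'k) mpoly set)" for s
  define Gt where "Gt s = (mono_span {e. s < wt w' e} :: ('v, 'k) mpoly set)" for s
  have ideals: "is_ideal (Ge s)" "is_ideal (Gt s)" for s
    unfolding Ge_def Gt_def using wt_mono[of w'] w'0
    by (fastforce intro!: is_ideal_mono_span simp: upset_def)+
  have GeGe: "p * q \<in> Ge (s + t)" if "p \<in> Ge s" "q \<in> Ge t" for p q s t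
    using that unfolding Ge_def by (rule mono_span_mult) auto
  have GtGe: "p * q \<in> Gt (s + t)" if "p \<in> Gt s" "q \<in> Ge t" for p q s t
    using that unfolding Ge_def Gt_def by (rule mono_span_mult) auto
  have L': "L \<subseteq> Ge c"
    using L wt_mono_weight[of w w'] w'(1) order_trans unfolding Ge_def mono_span_def by blast
  have powL: "ideal_pow L i \<subseteq> Ge (of_nat i * c)" for i
  proof (induction i)
    case 0
    have "0 \<le> wt w' e" for e using w'0 unfolding wt_def by (intro sum_nonneg) auto
    then show ?case by (simp add: Ge_def)
  next
    case (Suc i)
    have "{a * b |a b. a \<in> L \<and> b \<in> ideal_pow L i} \<subseteq> Ge (c + of_nat i * c)"
      using L' Suc GeGe by blast
    then show ?case
      unfolding ideal_pow.simps ideal_prod_def using ideal_of_subset[OF ideals(1)]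
      by (simp add: distrib_right)
  qed
  have ne: "wt w' ` Poly_Mapping.keys f \<noteq> {}" using e0 by blast
  obtain e1 where e1: "e1 \<in> Poly_Mapping.keys f" "Min (wt w' ` Poly_Mapping.keys f) = wt w' e1"
    using Min_in[OF _ ne] by auto
  have min: "wt w' e1 \<le> wt w' e" if "e \<in> Poly_Mapping.keys f" for e
    unfolding e1(2)[symmetric] using that by simp
  define m where "m = wt w' e1"
  have mc: "m < c" using min[OF e0] w'(2) by (simp add: m_def)
  define c1 where "c1 = Poly_Mapping.lookup f e1"
  have c1: "c1 \<noteq> 0" using e1 by (simp add: c1_def in_keys_iff)
  \<comment> \<open>Injectivity of \<open>wt w'\<close> on the keys makes \<open>e1\<close> the only
    monomial of least weight, so the rest of \<open>f\<close> has strictly larger order.\<close>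
  define f' where "f' = f - Poly_Mapping.single e1 c1"
  have f_eq: "f = Poly_Mapping.single e1 c1 + f'" by (simp add: f'_def)
  have f': "f' \<in> Gt m"
    unfolding Gt_def mono_span_def
  proof (intro CollectI subsetI)
    fix e assume "e \<in> Poly_Mapping.keys f'"
    then have nz: "Poly_Mapping.lookup f' e \<noteq> 0" by (simp add: in_keys_iff)
    then have "e \<noteq> e1" by (auto simp: f'_def lookup_minus c1_def)
    moreover from this have "e \<in> Poly_Mapping.keys f"
      using nz by (auto simp: f'_def lookup_minus lookup_single in_keys_iff)
    ultimately show "m < wt w' e"
      using min[of e] inj_onD[OF w'(3), of e1 e] e1(1) by (auto simp: m_def order_less_le)
  qed
  have fm: "f \<in> Ge m" using min by (auto simp: Ge_def mono_span_def m_def)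
  have powf: "f ^ n \<in> Ge (of_nat n * m)" for n
  proof (induction n)
    case (Suc n)
    then show ?case using GeGe[OF fm, of "f ^ n" "of_nat n * m"] by (simp add: distrib_right)
  qed (auto simp: Ge_def mono_span_def)
  \<comment> \<open>The lowest term of \<open>f ^ n\<close> is the power of the lowest term of
    \<open>f\<close>; over a field its coefficient \<open>c1 ^ n\<close> cannot vanish.\<close>
  have lead: "\<exists>E h. f ^ n = Poly_Mapping.single E (c1 ^ n) + h \<and> wt w' E = of_nat n * m
      \<and> h \<in> Gt (of_nat n * m)" for n
  proof (induction n)
    case 0
    show ?case by (intro exI[of _ 0]) (simp add: is_idealD(1)[OF ideals(2)])
  next
    case (Suc n)
    then obtain E h where Eh: "f ^ n = Poly_Mapping.single E (c1 ^ n) + h" "wt w' E = of_nat n * m"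
      "h \<in> Gt (of_nat n * m)" by blast
    have "f ^ Suc n = (Poly_Mapping.single e1 c1 + f') * f ^ n"
      unfolding f_eq[symmetric] by simp
    also have "\<dots> = Poly_Mapping.single e1 c1 * f ^ n + f' * f ^ n" by (rule distrib_right)
    also have "Poly_Mapping.single e1 c1 * f ^ n
        = Poly_Mapping.single (e1 + E) (c1 ^ Suc n) + h * Poly_Mapping.single e1 c1"
      unfolding Eh(1) by (simp add: distrib_left mult_single mult.commute)
    finally have "f ^ Suc n = Poly_Mapping.single (e1 + E) (c1 ^ Suc n)
        + (h * Poly_Mapping.single e1 c1 + f' * f ^ n)" by (simp add: add.assoc)
    moreover have "Poly_Mapping.single e1 c1 \<in> Ge m" unfolding Ge_def m_def by blast
    then have "h * Poly_Mapping.single e1 c1 \<in> Gt (of_nat n * m + m)" by (rule GtGe[OF Eh(3)])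
    moreover have "f' * f ^ n \<in> Gt (m + of_nat n * m)" by (rule GtGe[OF f' powf])
    ultimately show ?case
      using is_idealD(2)[OF ideals(2)] Eh(2)
      by (intro exI[of _ "e1 + E"] exI[of _ "h * Poly_Mapping.single e1 c1 + f' * f ^ n"])
        (simp add: m_def algebra_simps)
  qed
  obtain n a where n: "n \<ge> 1" and a: "\<forall>i\<in>{1..n}. a i \<in> ideal_pow L i"
    and eq: "f ^ n + (\<Sum>i=1..n. a i * f ^ (n - i)) = 0"
    using f unfolding int_closure_def by blast
  define R where "R = (\<Sum>i=1..n. a i * f ^ (n - i))"
  \<comment> \<open>Each summand has order at least \<open>i * c + (n - i) * m\<close>, which
    exceeds \<open>n * m\<close> because \<open>i \<ge> 1\<close> and \<open>m < c\<close>. Hence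
    \<open>R\<close> cannot cancel the lowest term of \<open>f ^ n\<close>.\<close>
  have R: "R \<in> Gt (of_nat n * m)"
    unfolding R_def
  proof (rule is_ideal_sum[OF ideals(2)])
    fix i assume i: "i \<in> {1..n}"
    have "a i * f ^ (n - i) \<in> Ge (of_nat i * c + of_nat (n - i) * m)"
      using a i by (intro GeGe[OF subsetD[OF powL] powf]) blast
    moreover have "of_nat n * m < of_nat i * c + of_nat (n - i) * m"
    proof -
      have "of_nat i * m < of_nat i * c" using mc i by simp
      moreover have "of_nat n * m = of_nat i * m + of_nat (n - i) * m"
        using i by (simp add: distrib_right[symmetric] flip: of_nat_add)
      ultimately show ?thesis by linarith
    qed
    ultimately show "a i * f ^ (n - i) \<in> Gt (of_nat n * m)"
      unfolding Ge_def Gt_def mono_span_def by fastforce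
  qed
  obtain E h where Eh: "f ^ n = Poly_Mapping.single E (c1 ^ n) + h" "wt w' E = of_nat n * m"
    "h \<in> Gt (of_nat n * m)" using lead by blast
  have "Poly_Mapping.lookup h E = 0" "Poly_Mapping.lookup R E = 0"
    using Eh(2,3) R unfolding Gt_def mono_span_def by (auto simp: in_keys_iff)
  then have "Poly_Mapping.lookup (f ^ n + R) E = c1 ^ n" unfolding Eh(1) by (simp add: lookup_add)
  then show False using eq c1 by (simp add: R_def)
qed

subsection \<open>Powers and integral closures of monomial ideals\<close>

text \<open>For up-closed \<open>U\<close> this says that \<open>X^(N e)\<close> lies in the
  \<open>n\<close>th power of the ideal of \<open>U\<close>. Lists allow repeated factors, and for
  \<open>n = 0\<close> the empty list matches the unit ideal.\<close>

definition dil_le :: "('v \<Rightarrow>\<^sub>0 nat) set \<Rightarrow> nat \<Rightarrow> nat \<Rightarrow> ('v \<Rightarrow>\<^sub>0 nat) \<Rightarrow> bool" where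
  "dil_le U N n e \<longleftrightarrow> (\<exists>xs. length xs = n \<and> set xs \<subseteq> U
    \<and> (\<forall>v. (\<Sum>x\<leftarrow>xs. Poly_Mapping.lookup x v) \<le> N * Poly_Mapping.lookup e v))"

definition exp_pow :: "('v \<Rightarrow>\<^sub>0 nat) set \<Rightarrow> nat \<Rightarrow> ('v \<Rightarrow>\<^sub>0 nat) set" where
  "exp_pow U n = {e. dil_le U 1 n e}"

definition exp_sat :: "('v \<Rightarrow>\<^sub>0 nat) set \<Rightarrow> ('v \<Rightarrow>\<^sub>0 nat) set" where
  "exp_sat U = {e. \<exists>N\<ge>1. dil_le U N N e}"

lemma dil_leI:
  "length xs = n \<Longrightarrow> set xs \<subseteq> U \<Longrightarrow>
    (\<And>v. (\<Sum>x\<leftarrow>xs. Poly_Mapping.lookup x v) \<le> N * Poly_Mapping.lookup e v) \<Longrightarrow> dil_le U N n e"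
  unfolding dil_le_def by blast

lemma dil_leE:
  assumes "dil_le U N n e"
  obtains xs where "length xs = n" "set xs \<subseteq> U"
    "\<And>v. (\<Sum>x\<leftarrow>xs. Poly_Mapping.lookup x v) \<le> N * Poly_Mapping.lookup e v"
  using assms unfolding dil_le_def by blast

lemma dil_le_exp_le: "dil_le U N n e \<Longrightarrow> exp_le e f \<Longrightarrow> dil_le U N n f"
  unfolding dil_le_def exp_le_def by (blast intro: mult_le_mono2 order_trans)

lemma upset_exp_pow [simp]: "upset (exp_pow U n)"
  unfolding upset_def exp_pow_def using dil_le_exp_le by blast

lemma upset_exp_sat [simp]: "upset (exp_sat U)"
  unfolding upset_def exp_sat_def using dil_le_exp_le by blast

lemma dil_le_mult:
  assumes "dil_le U N n e"
  shows "dil_le U (M * N) (M * n) e"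
proof -
  obtain xs where xs: "length xs = n" "set xs \<subseteq> U"
    "\<And>v. (\<Sum>x\<leftarrow>xs. Poly_Mapping.lookup x v) \<le> N * Poly_Mapping.lookup e v"
    using assms by (rule dil_leE) blast
  have "length (concat (replicate M xs)) = M * n \<and> set (concat (replicate M xs)) \<subseteq> U \<and>
    (\<forall>v. (\<Sum>x\<leftarrow>concat (replicate M xs). Poly_Mapping.lookup x v) \<le> M * N * Poly_Mapping.lookup e v)"
    using xs by (induction M) (auto simp: algebra_simps intro: add_mono)
  then show ?thesis unfolding dil_le_def by blast
qed

lemma dil_le_antimono:
  assumes "dil_le U N n e" "m \<le> n"
  shows "dil_le U N m e"
proof -
  obtain xs where xs: "length xs = n" "set xs \<subseteq> U"
    "\<And>v. (\<Sum>x\<leftarrow>xs. Poly_Mapping.lookup x v) \<le> N * Poly_Mapping.lookup e v"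
    using assms(1) by (rule dil_leE) blast
  have "(\<Sum>x\<leftarrow>take m xs. Poly_Mapping.lookup x v) \<le> N * Poly_Mapping.lookup e v" for v
    using sum_list_take_le[of "\<lambda>x. Poly_Mapping.lookup x v" m xs] xs(3)[of v] by linarith
  moreover have "set (take m xs) \<subseteq> U" using xs(2) set_take_subset by fastforce
  ultimately show ?thesis using xs(1) assms(2) by (intro dil_leI[of "take m xs"]) auto
qed

lemma lookup_sum_list:
  "Poly_Mapping.lookup (sum_list xs) v = (\<Sum>x\<leftarrow>xs. Poly_Mapping.lookup x v)"
  by (induction xs) (auto simp: lookup_add)

text \<open>A list of \<open>n\<close> exponents that each dominate a sum of \<open>k\<close>
  elements of \<open>U\<close> flattens to a list of length \<open>k * n\<close>; conversely such a
  list is cut into \<open>n\<close> blocks of length \<open>k\<close>, whose sums lie in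
  \<open>exp_pow U k\<close>. Integrality over a power thus becomes a condition on \<open>U\<close>
  itself.\<close>

lemma dil_le_exp_pow: "dil_le (exp_pow U k) N n e \<longleftrightarrow> dil_le U N (k * n) e"
proof
  assume "dil_le (exp_pow U k) N n e"
  then obtain ys where ys: "length ys = n" "set ys \<subseteq> exp_pow U k"
    "\<And>v. (\<Sum>x\<leftarrow>ys. Poly_Mapping.lookup x v) \<le> N * Poly_Mapping.lookup e v"
    by (rule dil_leE) blast
  have "\<exists>xs. length xs = k * length ys \<and> set xs \<subseteq> U \<and>
      (\<forall>v. (\<Sum>x\<leftarrow>xs. Poly_Mapping.lookup x v) \<le> (\<Sum>x\<leftarrow>ys. Poly_Mapping.lookup x v))"
    using ys(2)
  proof (induction ys)
    case (Cons y ys)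
    then obtain xs where xs: "length xs = k * length ys" "set xs \<subseteq> U"
      "\<And>v. (\<Sum>x\<leftarrow>xs. Poly_Mapping.lookup x v) \<le> (\<Sum>x\<leftarrow>ys. Poly_Mapping.lookup x v)" by auto
    have "dil_le U 1 k y" using Cons.prems by (simp add: exp_pow_def)
    then obtain zs where zs: "length zs = k" "set zs \<subseteq> U"
      "\<And>v. (\<Sum>x\<leftarrow>zs. Poly_Mapping.lookup x v) \<le> 1 * Poly_Mapping.lookup y v" by (rule dil_leE) blast
    then show ?case using xs by (intro exI[of _ "zs @ xs"]) (auto intro: add_mono)
  qed simp
  then show "dil_le U N (k * n) e" using ys(1,3) unfolding dil_le_def by (meson order_trans)
next
  assume "dil_le U N (k * n) e"
  then obtain xs where xs: "length xs = k * n" "set xs \<subseteq> U"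
    "\<And>v. (\<Sum>x\<leftarrow>xs. Poly_Mapping.lookup x v) \<le> N * Poly_Mapping.lookup e v"
    by (rule dil_leE) blast
  have "\<exists>ys. length ys = n \<and> set ys \<subseteq> exp_pow U k \<and>
      (\<forall>v. (\<Sum>x\<leftarrow>ys. Poly_Mapping.lookup x v) = (\<Sum>x\<leftarrow>xs. Poly_Mapping.lookup x v))"
    using xs(1,2)
  proof (induction n arbitrary: xs)
    case 0
    then show ?case by simp
  next
    case (Suc n)
    have "set (drop k xs) \<subseteq> U" using Suc.prems(2) set_drop_subset by fastforce
    then obtain ys where ys: "length ys = n" "set ys \<subseteq> exp_pow U k"
      "\<And>v. (\<Sum>x\<leftarrow>ys. Poly_Mapping.lookup x v) = (\<Sum>x\<leftarrow>drop k xs. Poly_Mapping.lookup x v)"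
      using Suc.IH[of "drop k xs"] Suc.prems(1) by auto
    let ?z = "sum_list (take k xs)"
    have "set (take k xs) \<subseteq> U" using Suc.prems(2) set_take_subset by fastforce
    then have "?z \<in> exp_pow U k"
      unfolding exp_pow_def using Suc.prems(1)
      by (intro CollectI dil_leI[of "take k xs"]) (auto simp: lookup_sum_list)
    moreover have "(\<Sum>x\<leftarrow>xs. Poly_Mapping.lookup x v) =
        (\<Sum>x\<leftarrow>take k xs. Poly_Mapping.lookup x v) + (\<Sum>x\<leftarrow>drop k xs. Poly_Mapping.lookup x v)" for v
      by (simp flip: sum_list_append map_append)
    ultimately show ?case
      using ys by (intro exI[of _ "?z # ys"]) (auto simp: lookup_sum_list)
  qed
  then show "dil_le (exp_pow U k) N n e" using xs(3) unfolding dil_le_def by metis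
qed

lemma exp_sat_exp_pow: "exp_sat (exp_pow U k) = {e. \<exists>N\<ge>1. dil_le U N (k * N) e}"
  by (simp add: exp_sat_def dil_le_exp_pow)

lemma exp_pow_0 [simp]: "exp_pow U 0 = UNIV"
  by (auto simp: exp_pow_def dil_le_def)

lemma exp_pow_Suc: "{a + b | a b. a \<in> U \<and> b \<in> exp_pow U n} = exp_pow U (Suc n)"
proof (intro equalityI subsetI)
  fix e assume "e \<in> {a + b |a b. a \<in> U \<and> b \<in> exp_pow U n}"
  then obtain a b where ab: "e = a + b" "a \<in> U" "dil_le U 1 n b" by (auto simp: exp_pow_def)
  obtain xs where "length xs = n" "set xs \<subseteq> U"
    "\<And>v. (\<Sum>x\<leftarrow>xs. Poly_Mapping.lookup x v) \<le> 1 * Poly_Mapping.lookup b v"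
    using ab(3) by (rule dil_leE) blast
  then show "e \<in> exp_pow U (Suc n)"
    unfolding exp_pow_def using ab
    by (intro CollectI dil_leI[of "a # xs"]) (auto simp: lookup_add)
next
  fix e assume "e \<in> exp_pow U (Suc n)"
  then have "dil_le U 1 (Suc n) e" by (simp add: exp_pow_def)
  then obtain ys where ys: "length ys = Suc n" "set ys \<subseteq> U"
    "\<And>v. (\<Sum>x\<leftarrow>ys. Poly_Mapping.lookup x v) \<le> 1 * Poly_Mapping.lookup e v" by (rule dil_leE) blast
  then obtain a xs where a: "ys = a # xs" by (cases ys) auto
  have le: "Poly_Mapping.lookup a v + (\<Sum>x\<leftarrow>xs. Poly_Mapping.lookup x v) \<le> Poly_Mapping.lookup e v" for v
    using ys(3)[of v] a by simp
  have "exp_le a e" unfolding exp_le_def using le by (meson add_leD1)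
  \<comment> \<open>All slack in the bound goes to the second summand \<open>e - a\<close>.\<close>
  then have "e = a + (e - a)" by (simp add: exp_le_add_diff)
  moreover have "(\<Sum>x\<leftarrow>xs. Poly_Mapping.lookup x v) \<le> Poly_Mapping.lookup (e - a) v" for v
    using le[of v] by (simp add: lookup_minus)
  then have "e - a \<in> exp_pow U n"
    unfolding exp_pow_def using ys a by (intro CollectI dil_leI[of xs]) auto
  ultimately show "e \<in> {a + b |a b. a \<in> U \<and> b \<in> exp_pow U n}" using ys(2) a by auto
qed

lemma ideal_pow_mono_span:
  assumes "upset U"
  shows "ideal_pow (mono_span U) n = (mono_span (exp_pow U n) :: ('v, 'k::comm_ring_1) mpoly set)"
  by (induction n) (simp_all add: ideal_prod_mono_span[OF assms] exp_pow_Suc)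

lemma monom_power:
  "\<exists>E. (Defs.monom e ^ N :: ('v, 'k::comm_ring_1) mpoly) = Defs.monom E \<and> (\<forall>v. Poly_Mapping.lookup E v = N * Poly_Mapping.lookup e v)"
proof (induction N)
  case 0
  show ?case by (intro exI[of _ 0]) (simp add: Defs.monom_def)
next
  case (Suc N)
  then obtain E where "(Defs.monom e ^ N :: ('v, 'k) mpoly) = Defs.monom E"
    "\<forall>v. Poly_Mapping.lookup E v = N * Poly_Mapping.lookup e v" by blast
  then show ?case
    by (intro exI[of _ "e + E"]) (simp add: Defs.monom_def mult_single lookup_add)
qed

text \<open>For an exponent of an integral element, \<open>int_closure_wt_le\<close> rules out a
  separating weight, so the integral combination remains and puts it into \<open>exp_sat U\<close>.
  The converse is \<open>linear_combination_int_closure\<close>, once all monomials share one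
  \<open>N\<close>.\<close>

lemma int_closure_mono_span:
  fixes U :: "('v::finite \<Rightarrow>\<^sub>0 nat) set"
  assumes U: "upset U"
  shows "int_closure (mono_span U) = (mono_span (exp_sat U) :: ('v, 'k::field) mpoly set)"
proof (intro equalityI subsetI)
  fix f :: "('v, 'k) mpoly" assume f: "f \<in> int_closure (mono_span U)"
  have "e0 \<in> exp_sat U" if e0: "e0 \<in> Poly_Mapping.keys f" for e0
  proof (rule integral_combination_or_weight[OF finite_min_exps[of U],
        where g = Poly_Mapping.lookup and e = "Poly_Mapping.lookup e0" and \<nu> = 1])
    fix N xs assume "1 \<le> N" "length xs = N * 1" "set xs \<subseteq> min_exps U"
      "\<And>v. (\<Sum>x\<leftarrow>xs. Poly_Mapping.lookup x v) \<le> N * Poly_Mapping.lookup e0 v"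
    moreover have "min_exps U \<subseteq> U" by (auto simp: min_exps_def)
    ultimately show "e0 \<in> exp_sat U"
      unfolding exp_sat_def by (intro CollectI exI[of _ N] conjI dil_leI[of xs]) auto
  next
    fix w :: "'v \<Rightarrow> rat" and c
    assume w: "\<And>v. 0 \<le> w v" and "0 < c"
      and g: "\<And>j. j \<in> min_exps U \<Longrightarrow> c \<le> (\<Sum>v\<in>UNIV. w v * of_nat (Poly_Mapping.lookup j v))"
      and e: "(\<Sum>v\<in>UNIV. w v * of_nat (Poly_Mapping.lookup e0 v)) < of_nat 1 * c"
    \<comment> \<open>The bound is known on minimal exponents only; nonnegative weights carry it to
      the elements above them.\<close>
    have "c \<le> wt w u" if u: "u \<in> U" for u
    proof -
      obtain g' where g': "g' \<in> min_exps U" "exp_le g' u" using ex_min_exps_le[OF u] by blast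
      show ?thesis using g[OF g'(1), folded wt_def] wt_mono[where w = w, OF w g'(2)] by linarith
    qed
    then have "mono_span U \<subseteq> (mono_span {e. c \<le> wt w e} :: ('v, 'k) mpoly set)"
      by (auto simp: mono_span_def)
    from int_closure_wt_le[where w = w, OF w this f e0] show "e0 \<in> exp_sat U"
      using e by (simp add: wt_def)
  qed
  then show "f \<in> mono_span (exp_sat U)" by (auto simp: mono_span_def)
next
  fix f :: "('v, 'k) mpoly" assume f: "f \<in> mono_span (exp_sat U)"
  then have "\<forall>e\<in>Poly_Mapping.keys f. \<exists>N\<ge>1. dil_le U N N e"
    by (auto simp: mono_span_def exp_sat_def)
  then obtain M where M: "\<And>e. e \<in> Poly_Mapping.keys f \<Longrightarrow> M e \<ge> 1 \<and> dil_le U (M e) (M e) e"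
    by metis
  \<comment> \<open>A common multiple of the individual \<open>M e\<close>.\<close>
  define N where "N = prod M (Poly_Mapping.keys f)"
  have N: "1 \<le> N" unfolding N_def using M by (intro prod_ge_1) auto
  have pow: "Defs.monom e ^ N \<in> ideal_pow (mono_span U :: ('v, 'k) mpoly set) N"
    if e: "e \<in> Poly_Mapping.keys f" for e
  proof -
    obtain k where "N = k * M e"
      using e unfolding N_def by (metis dvd_def dvd_prodI finite_keys mult.commute)
    then have "dil_le U N N e" using dil_le_mult[of U "M e" "M e" e k] M[OF e] by simp
    moreover obtain E where "(Defs.monom e ^ N :: ('v, 'k) mpoly) = Defs.monom E"
      "\<And>v. Poly_Mapping.lookup E v = N * Poly_Mapping.lookup e v"
      using monom_power[of e N] by blast
    ultimately show ?thesis
      unfolding ideal_pow_mono_span[OF U] by (simp add: exp_pow_def dil_le_def)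
  qed
  have "f = (\<Sum>e\<in>Poly_Mapping.keys f. Poly_Mapping.single 0 (Poly_Mapping.lookup f e) * Defs.monom e)"
    unfolding single_eq_mult_monom[symmetric] by (rule sum_singles_keys)
  also have "\<dots> \<in> int_closure (mono_span U)"
    by (rule linear_combination_int_closure[OF _ N pow]) simp_all
  finally show "f \<in> int_closure (mono_span U)" .
qed

subsection \<open>Extension to the larger polynomial ring\<close>

definition projA :: "('x::finite + 'y \<Rightarrow>\<^sub>0 nat) \<Rightarrow> ('x \<Rightarrow>\<^sub>0 nat)" where
  "projA e = Abs_poly_mapping (\<lambda>x. Poly_Mapping.lookup e (Inl x))"

definition projB :: "('x + 'y::finite \<Rightarrow>\<^sub>0 nat) \<Rightarrow> ('y \<Rightarrow>\<^sub>0 nat)" where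
  "projB e = Abs_poly_mapping (\<lambda>y. Poly_Mapping.lookup e (Inr y))"

lemma lookup_proj [simp]:
  "Poly_Mapping.lookup (projA e) x = Poly_Mapping.lookup e (Inl x)"
  "Poly_Mapping.lookup (projB e) y = Poly_Mapping.lookup e (Inr y)"
  by (simp_all add: projA_def projB_def)

lemma lookup_exp [simp]:
  fixes e :: "'x::finite \<Rightarrow>\<^sub>0 nat" and f :: "'y::finite \<Rightarrow>\<^sub>0 nat"
  shows "Poly_Mapping.lookup (expA e :: 'x + 'y \<Rightarrow>\<^sub>0 nat) v =
      (case v of Inl x \<Rightarrow> Poly_Mapping.lookup e x | Inr _ \<Rightarrow> 0)"
    "Poly_Mapping.lookup (expB f :: 'x + 'y \<Rightarrow>\<^sub>0 nat) v =
      (case v of Inl _ \<Rightarrow> 0 | Inr y \<Rightarrow> Poly_Mapping.lookup f y)"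
  by (simp_all add: expA_def expB_def)

lemma proj_exp [simp]:
  fixes e :: "'x::finite \<Rightarrow>\<^sub>0 nat" and f :: "'y::finite \<Rightarrow>\<^sub>0 nat"
  shows "projA (expA e :: 'x + 'y \<Rightarrow>\<^sub>0 nat) = e" "projB (expB f :: 'x + 'y \<Rightarrow>\<^sub>0 nat) = f"
  by (auto intro!: poly_mapping_eqI)

lemma expA_add_expB: "expA (projA e) + expB (projB e) = (e :: 'x::finite + 'y::finite \<Rightarrow>\<^sub>0 nat)"
  by (auto intro!: poly_mapping_eqI simp: lookup_add split: sum.splits)

lemma upset_vimage_proj:
  "upset U \<Longrightarrow> upset (projA -` U :: ('x::finite + 'y::finite \<Rightarrow>\<^sub>0 nat) set)"
  "upset V \<Longrightarrow> upset (projB -` V :: ('x::finite + 'y::finite \<Rightarrow>\<^sub>0 nat) set)"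
  unfolding upset_def exp_le_def by (metis lookup_proj(1) vimage_eq, metis lookup_proj(2) vimage_eq)

lemma emb_monom:
  "embA (Defs.monom e) = (Defs.monom (expA e) :: ('x::finite + 'y::finite, 'k::comm_ring_1) mpoly)"
  "embB (Defs.monom f) = (Defs.monom (expB f) :: ('x::finite + 'y::finite, 'k::comm_ring_1) mpoly)"
  by (simp_all add: embA_def embB_def Defs.monom_def)

lemma monom_add: "Defs.monom (e + f) = Defs.monom e * Defs.monom f"
  by (simp add: Defs.monom_def mult_single)

text \<open>A monomial whose \<open>X\<close> part lies in \<open>U\<close> is an embedded element
  of the ideal times its \<open>Y\<close> part, which the extended ideal absorbs.\<close>

lemma extA_mono_span:
  assumes "upset U"
  shows "extA (mono_span U) =
    (mono_span (projA -` U) :: ('x::finite + 'y::finite, 'k::comm_ring_1) mpoly set)"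
  unfolding extA_def
proof (rule ideal_of_eq_mono_span[OF upset_vimage_proj(1)[OF assms]])
  show "embA ` mono_span U \<subseteq> (mono_span (projA -` U) :: ('x + 'y, 'k) mpoly set)"
  proof clarify
    fix p :: "('x, 'k) mpoly" assume "p \<in> mono_span U"
    then show "embA p \<in> (mono_span (projA -` U) :: ('x + 'y, 'k) mpoly set)"
      unfolding embA_def
      by (intro is_ideal_sum[OF is_ideal_mono_span[OF upset_vimage_proj(1)[OF assms]]]
          single_mem_mono_span) (auto simp: mono_span_def)
  qed
  fix e :: "'x + 'y \<Rightarrow>\<^sub>0 nat" assume "e \<in> projA -` U"
  then have "embA (Defs.monom (projA e)) \<in> ideal_of (embA ` mono_span U :: ('x + 'y, 'k) mpoly set)"
    by (intro subsetD[OF subset_ideal_of] imageI) simp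
  then have "(Defs.monom (expA (projA e)) :: ('x + 'y, 'k) mpoly) * Defs.monom (expB (projB e))
      \<in> ideal_of (embA ` mono_span U)"
    unfolding emb_monom by (rule is_idealD(4)[OF is_ideal_ideal_of])
  then show "(Defs.monom e :: ('x + 'y, 'k) mpoly) \<in> ideal_of (embA ` mono_span U)"
    unfolding monom_add[symmetric] expA_add_expB .
qed

lemma extB_mono_span:
  assumes "upset V"
  shows "extB (mono_span V) =
    (mono_span (projB -` V) :: ('x::finite + 'y::finite, 'k::comm_ring_1) mpoly set)"
  unfolding extB_def
proof (rule ideal_of_eq_mono_span[OF upset_vimage_proj(2)[OF assms]])
  show "embB ` mono_span V \<subseteq> (mono_span (projB -` V) :: ('x + 'y, 'k) mpoly set)"
  proof clarify
    fix p :: "('y, 'k) mpoly" assume "p \<in> mono_span V"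
    then show "embB p \<in> (mono_span (projB -` V) :: ('x + 'y, 'k) mpoly set)"
      unfolding embB_def
      by (intro is_ideal_sum[OF is_ideal_mono_span[OF upset_vimage_proj(2)[OF assms]]]
          single_mem_mono_span) (auto simp: mono_span_def)
  qed
  fix e :: "'x + 'y \<Rightarrow>\<^sub>0 nat" assume "e \<in> projB -` V"
  then have "embB (Defs.monom (projB e)) \<in> ideal_of (embB ` mono_span V :: ('x + 'y, 'k) mpoly set)"
    by (intro subsetD[OF subset_ideal_of] imageI) simp
  then have "(Defs.monom (expA (projA e)) :: ('x + 'y, 'k) mpoly) * Defs.monom (expB (projB e))
      \<in> ideal_of (embB ` mono_span V)"
    unfolding emb_monom by (rule is_idealD(3)[OF is_ideal_ideal_of])
  then show "(Defs.monom e :: ('x + 'y, 'k) mpoly) \<in> ideal_of (embB ` mono_span V)"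
    unfolding monom_add[symmetric] expA_add_expB .
qed

lemma ideal_Union_mono_span:
  assumes "\<And>l. l \<in> A \<Longrightarrow> upset (W l)"
  shows "ideal_of (\<Union>l\<in>A. mono_span (W l)) =
    (mono_span (\<Union>l\<in>A. W l) :: ('v, 'k::comm_ring_1) mpoly set)"
proof (rule ideal_of_eq_mono_span)
  show "upset (\<Union>l\<in>A. W l)" using assms unfolding upset_def by blast
  show "(\<Union>l\<in>A. mono_span (W l)) \<subseteq> (mono_span (\<Union>l\<in>A. W l) :: ('v, 'k) mpoly set)"
    unfolding mono_span_def by blast
  fix e assume "e \<in> (\<Union>l\<in>A. W l)"
  then have "(Defs.monom e :: ('v, 'k) mpoly) \<in> (\<Union>l\<in>A. mono_span (W l))" by simp
  then show "(Defs.monom e :: ('v, 'k) mpoly) \<in> ideal_of (\<Union>l\<in>A. mono_span (W l))"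
    by (rule subsetD[OF subset_ideal_of])
qed

text \<open>The two ideals live in disjoint sets of variables, so their product is their
  intersection: the \<open>X\<close> part of a common monomial lies in one factor and the
  \<open>Y\<close> part in the other.\<close>

lemma prod_ext_mono_span:
  assumes "upset U" "upset V"
  shows "ideal_prod (extA (mono_span U)) (extB (mono_span V)) =
    (mono_span (projA -` U \<inter> projB -` V) :: ('x::finite + 'y::finite, 'k::comm_ring_1) mpoly set)"
proof -
  have "{a + b |a b. a \<in> projA -` U \<and> b \<in> projB -` V} = projA -` U \<inter> (projB -` V :: ('x + 'y \<Rightarrow>\<^sub>0 nat) set)"
  proof (intro equalityI subsetI)
    fix e assume "e \<in> {a + b |a b. a \<in> projA -` U \<and> b \<in> (projB -` V :: ('x + 'y \<Rightarrow>\<^sub>0 nat) set)}"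
    then obtain a b where "e = a + b" "a \<in> projA -` U" "b \<in> projB -` V" by blast
    then show "e \<in> projA -` U \<inter> projB -` V"
      using upset_vimage_proj[where ?'x = 'x and ?'y = 'y] assms upset_add add.commute
      by (metis IntI)
  next
    fix e assume e: "e \<in> projA -` U \<inter> (projB -` V :: ('x + 'y \<Rightarrow>\<^sub>0 nat) set)"
    then have "expA (projA e) \<in> (projA -` U :: ('x + 'y \<Rightarrow>\<^sub>0 nat) set)"
      "expB (projB e) \<in> (projB -` V :: ('x + 'y \<Rightarrow>\<^sub>0 nat) set)" by auto
    then show "e \<in> {a + b |a b. a \<in> projA -` U \<and> b \<in> projB -` V}"
      using expA_add_expB[of e, symmetric] by blast
  qed
  then show ?thesis
    unfolding extA_mono_span[OF assms(1)] extB_mono_span[OF assms(2)]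
      ideal_prod_mono_span[OF upset_vimage_proj(1)[OF assms(1)]] by simp
qed

subsection \<open>The linear program\<close>

lemma mingens_mono_span: "mingens (mono_span U :: ('v, 'k::comm_ring_1) mpoly set) = min_exps U"
  by (auto simp: mingens_def min_exps_def)

text \<open>Restates an integral optimal value without reals: \<open>nat z\<close> bounds every
  ratio \<open>p / N\<close> and is itself such a ratio. The bound holds because lists yield
  feasible points; it is attained because a separating weight would push the optimum below
  \<open>z\<close>.\<close>

lemma nu_star_integral:
  fixes U :: "('v::finite \<Rightarrow>\<^sub>0 nat) set"
  assumes nu: "nu_star (mono_span U :: ('v, 'k::comm_ring_1) mpoly set) (Poly_Mapping.lookup a) = ereal (of_int z)"
  shows "(\<forall>N p. 1 \<le> N \<longrightarrow> dil_le U N p a \<longrightarrow> p \<le> nat z * N) \<and> (\<exists>N\<ge>1. dil_le U N (nat z * N) a)"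
proof -
  define G where "G = min_exps U"
  have finG: "finite G" unfolding G_def by (rule finite_min_exps)
  define feas where "feas y \<longleftrightarrow> (\<forall>g. 0 \<le> y g) \<and>
    (\<forall>v. (\<Sum>g\<in>G. y g * real (Poly_Mapping.lookup g v)) \<le> real (Poly_Mapping.lookup a v))"
    for y :: "('v \<Rightarrow>\<^sub>0 nat) \<Rightarrow> real"
  have nu': "Sup {ereal (\<Sum>g\<in>G. y g) | y. feas y} = ereal (of_int z)"
    using nu unfolding nu_star_def mingens_mono_span G_def feas_def .
  have upper: "(\<Sum>g\<in>G. y g) \<le> of_int z" if "feas y" for y
  proof -
    have "ereal (\<Sum>g\<in>G. y g) \<le> Sup {ereal (\<Sum>g\<in>G. y g) | y. feas y}"
      using that by (intro Sup_upper) blast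
    then show ?thesis unfolding nu' by simp
  qed
  \<comment> \<open>The zero vector is feasible, so \<open>nat z\<close> loses nothing.\<close>
  have z: "0 \<le> z" using upper[of "\<lambda>_. 0"] by (simp add: feas_def)
  have bound: "p \<le> nat z * N" if N: "1 \<le> N" and dil: "dil_le U N p a" for N p
  proof -
    obtain xs where xs: "length xs = p" "set xs \<subseteq> U"
      "\<And>v. (\<Sum>x\<leftarrow>xs. Poly_Mapping.lookup x v) \<le> N * Poly_Mapping.lookup a v"
      using dil by (rule dil_leE) blast
    obtain h where h: "\<And>x. x \<in> U \<Longrightarrow> h x \<in> G \<and> exp_le (h x) x"
      using ex_min_exps_le unfolding G_def by metis
    define ys where "ys = map h xs"
    have ysG: "set ys \<subseteq> G" using h xs(2) by (auto simp: ys_def)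
    \<comment> \<open>Each list element has been replaced by a minimal generator below it; the
      multiplicities divided by \<open>N\<close> form a feasible point of value
      \<open>p / N\<close>.\<close>
    define y where "y g = real (count_list ys g) / real N" for g
    have "(\<Sum>g\<in>G. y g * real (Poly_Mapping.lookup g v)) \<le> real (Poly_Mapping.lookup a v)" for v
    proof -
      have "(\<Sum>x\<leftarrow>ys. Poly_Mapping.lookup x v) \<le> (\<Sum>x\<leftarrow>xs. Poly_Mapping.lookup x v)"
        unfolding ys_def map_map o_def using h xs(2) by (intro sum_list_mono) (auto simp: exp_le_def)
      then have "(\<Sum>g\<in>G. count_list ys g * Poly_Mapping.lookup g v) \<le> N * Poly_Mapping.lookup a v"
        using xs(3)[of v] sum_list_map_eq_sum_count2[OF ysG finG, of "\<lambda>x. Poly_Mapping.lookup x v"]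
        by linarith
      then have "real (\<Sum>g\<in>G. count_list ys g * Poly_Mapping.lookup g v) \<le> real (N * Poly_Mapping.lookup a v)"
        by (simp only: of_nat_le_iff)
      then have "real (\<Sum>g\<in>G. count_list ys g * Poly_Mapping.lookup g v) / real N \<le> real (Poly_Mapping.lookup a v)"
        using N by (simp add: pos_divide_le_eq mult.commute)
      moreover have "(\<Sum>g\<in>G. y g * real (Poly_Mapping.lookup g v)) =
          real (\<Sum>g\<in>G. count_list ys g * Poly_Mapping.lookup g v) / real N"
        by (simp add: y_def sum_divide_distrib)
      ultimately show ?thesis by simp
    qed
    then have "feas y" unfolding feas_def by (simp add: y_def)
    then have "(\<Sum>g\<in>G. y g) \<le> of_int z" by (rule upper)
    moreover have "(\<Sum>g\<in>G. y g) = real p / real N"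
      using sum_count_set[OF ysG finG] xs(1)
      by (simp add: y_def ys_def flip: sum_divide_distrib of_nat_sum)
    ultimately have "real p \<le> of_int z * real N" using N by (simp add: field_simps)
    also have "\<dots> = real (nat z * N)" using z by simp
    finally show ?thesis by (simp only: of_nat_le_iff)
  qed
  have attained: "\<exists>N\<ge>1. dil_le U N (nat z * N) a"
  proof (rule integral_combination_or_weight[OF finG,
        where g = Poly_Mapping.lookup and e = "Poly_Mapping.lookup a" and \<nu> = "nat z"])
    fix N xs assume "1 \<le> N" "length xs = N * nat z" "set xs \<subseteq> G"
      "\<And>v. (\<Sum>x\<leftarrow>xs. Poly_Mapping.lookup x v) \<le> N * Poly_Mapping.lookup a v"
    moreover have "G \<subseteq> U" by (auto simp: G_def min_exps_def)
    ultimately show ?thesis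
      by (intro exI[of _ N] conjI dil_leI[of xs]) (auto simp: mult.commute)
  next
    fix w :: "'v \<Rightarrow> rat" and c
    assume w: "\<And>v. 0 \<le> w v" and c: "0 < c"
      and g: "\<And>j. j \<in> G \<Longrightarrow> c \<le> (\<Sum>v\<in>UNIV. w v * of_nat (Poly_Mapping.lookup j v))"
      and e: "(\<Sum>v\<in>UNIV. w v * of_nat (Poly_Mapping.lookup a v)) < of_nat (nat z) * c"
    define w' where "w' v = real_of_rat (w v)" for v
    define c' where "c' = real_of_rat c"
    define W where "W = (\<Sum>v\<in>UNIV. w' v * real (Poly_Mapping.lookup a v))"
    have wt_real: "real_of_rat (\<Sum>v\<in>UNIV. w v * of_nat (Poly_Mapping.lookup j v)) =
        (\<Sum>v\<in>UNIV. w' v * real (Poly_Mapping.lookup j v))" for j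
      by (simp add: of_rat_sum of_rat_mult w'_def)
    have w'0: "0 \<le> w' v" for v using w by (simp add: w'_def)
    have c'0: "0 < c'" using c by (simp add: c'_def)
    have g': "c' \<le> (\<Sum>v\<in>UNIV. w' v * real (Poly_Mapping.lookup j v))" if "j \<in> G" for j
      unfolding wt_real[symmetric] c'_def of_rat_less_eq using g[OF that] .
    have "real_of_rat (\<Sum>v\<in>UNIV. w v * of_nat (Poly_Mapping.lookup a v)) < real_of_rat (of_nat (nat z) * c)"
      using e by (simp only: of_rat_less)
    then have W: "W < of_int z * c'"
      unfolding wt_real W_def using z by (simp add: of_rat_mult c'_def)
    \<comment> \<open>Weak duality: \<open>c'\<close> times the value of \<open>y\<close> is at most
      the weight of the combination of generators, hence at most the weight \<open>W\<close> of
      \<open>a\<close>.\<close>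
    have weak: "(\<Sum>g\<in>G. y g) \<le> W / c'" if y: "feas y" for y
    proof -
      have "(\<Sum>g\<in>G. y g) * c' \<le> (\<Sum>g\<in>G. y g * (\<Sum>v\<in>UNIV. w' v * real (Poly_Mapping.lookup g v)))"
        unfolding sum_distrib_right using y g' by (intro sum_mono mult_left_mono) (auto simp: feas_def)
      also have "\<dots> = (\<Sum>v\<in>UNIV. w' v * (\<Sum>g\<in>G. y g * real (Poly_Mapping.lookup g v)))"
        unfolding sum_distrib_left by (subst sum.swap) (simp add: mult.left_commute)
      also have "\<dots> \<le> W"
        unfolding W_def using y w'0 by (intro sum_mono mult_left_mono) (auto simp: feas_def)
      finally show ?thesis using c'0 by (simp add: pos_le_divide_eq)
    qed
    have "Sup {ereal (\<Sum>g\<in>G. y g) | y. feas y} \<le> ereal (W / c')"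
      using weak by (intro Sup_least) auto
    then have "of_int z \<le> W / c'" unfolding nu' by simp
    then show ?thesis using W c'0 by (simp add: pos_le_divide_eq)
  qed
  show ?thesis using bound attained by blast
qed

text \<open>In a witness for the left side the ratio \<open>p / N\<close> may be fractional. The
  integer \<open>\<nu>\<close> bounds it from above and is still attained, perhaps with another
  denominator \<open>M\<close>; so the \<open>X\<close> part reaches \<open>\<nu>\<close> while the
  \<open>Y\<close> part retains enough.\<close>

lemma exp_sat_exp_pow_sum:
  fixes U :: "('x::finite \<Rightarrow>\<^sub>0 nat) set" and V :: "('y::finite \<Rightarrow>\<^sub>0 nat) set"
  assumes nu: "\<And>a. \<exists>\<nu>. (\<forall>N p. 1 \<le> N \<longrightarrow> dil_le U N p a \<longrightarrow> p \<le> \<nu> * N) \<and> (\<exists>N\<ge>1. dil_le U N (\<nu> * N) a)"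
  shows "exp_sat (exp_pow (projA -` U \<union> projB -` V) k) =
    (\<Union>l\<in>{0..k}. projA -` exp_sat (exp_pow U l) \<inter> projB -` exp_sat (exp_pow V (k - l)))"
    (is "?L = ?R")
proof (intro equalityI subsetI)
  fix e :: "'x + 'y \<Rightarrow>\<^sub>0 nat" assume "e \<in> ?L"
  then obtain N where N: "N \<ge> 1" and "dil_le (projA -` U \<union> projB -` V) N (k * N) e"
    by (auto simp: exp_sat_exp_pow)
  from this(2) obtain xs where xs: "length xs = k * N" "set xs \<subseteq> projA -` U \<union> projB -` V"
    "\<And>v. (\<Sum>x\<leftarrow>xs. Poly_Mapping.lookup x v) \<le> N * Poly_Mapping.lookup e v"
    by (rule dil_leE) blast
  \<comment> \<open>Elements in both sets are counted for \<open>U\<close>; the remaining ones must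
    project into \<open>V\<close>.\<close>
  let ?P = "\<lambda>x. projA x \<in> U"
  define p where "p = length (filter ?P xs)"
  define q where "q = length (filter (\<lambda>x. \<not> ?P x) xs)"
  have pq: "p + q = k * N" unfolding p_def q_def sum_length_filter_compl xs(1) ..
  have filt: "(\<Sum>x\<leftarrow>filter Q xs. Poly_Mapping.lookup x v) \<le> N * Poly_Mapping.lookup e v" for Q v
    using sum_list_filter_le_nat xs(3)[of v] by (rule order_trans)
  have dA: "dil_le U N p (projA e)"
    by (rule dil_leI[of "map projA (filter ?P xs)"])
      (use filt in \<open>auto simp: p_def o_def\<close>)
  have dB: "dil_le V N q (projB e)"
    by (rule dil_leI[of "map projB (filter (\<lambda>x. \<not> ?P x) xs)"])
      (use xs(2) filt in \<open>auto simp: q_def o_def\<close>)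
  obtain \<nu> where \<nu>: "p \<le> \<nu> * N" "\<exists>M\<ge>1. dil_le U M (\<nu> * M) (projA e)"
    using nu[of "projA e"] N dA by blast
  \<comment> \<open>For \<open>\<nu> \<le> k\<close>, the bound on \<open>p\<close> leaves
    \<open>q \<ge> (k - \<nu>) * N\<close>. For \<open>\<nu> > k\<close>, the exponent
    \<open>k - l\<close> is 0 and \<open>\<nu> * M\<close> is cut down to
    \<open>k * M\<close>.\<close>
  define l where "l = min \<nu> k"
  obtain M where M: "M \<ge> 1" "dil_le U M (\<nu> * M) (projA e)" using \<nu>(2) by blast
  have "dil_le U M (l * M) (projA e)"
    using M(2) by (rule dil_le_antimono) (simp add: l_def)
  then have "projA e \<in> exp_sat (exp_pow U l)" using M(1) by (auto simp: exp_sat_exp_pow)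
  moreover have "(k - l) * N \<le> q"
  proof (cases "\<nu> \<le> k")
    case True
    then show ?thesis using pq \<nu>(1) by (simp add: l_def diff_mult_distrib)
  qed (simp add: l_def)
  then have "dil_le V N ((k - l) * N) (projB e)" by (rule dil_le_antimono[OF dB])
  then have "projB e \<in> exp_sat (exp_pow V (k - l))" using N by (auto simp: exp_sat_exp_pow)
  moreover have "l \<in> {0..k}" by (simp add: l_def)
  ultimately show "e \<in> ?R" by blast
next
  fix e :: "'x + 'y \<Rightarrow>\<^sub>0 nat" assume "e \<in> ?R"
  then obtain l M N where l: "l \<le> k" and M: "M \<ge> 1" "dil_le U M (l * M) (projA e)"
    and N: "N \<ge> 1" "dil_le V N ((k - l) * N) (projB e)"
    by (auto simp: exp_sat_exp_pow)
  obtain xs where xs: "length xs = N * (l * M)" "set xs \<subseteq> U"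
    "\<And>v. (\<Sum>x\<leftarrow>xs. Poly_Mapping.lookup x v) \<le> N * M * Poly_Mapping.lookup (projA e) v"
    using dil_le_mult[OF M(2), of N] by (rule dil_leE) blast
  obtain ys where ys: "length ys = M * ((k - l) * N)" "set ys \<subseteq> V"
    "\<And>v. (\<Sum>x\<leftarrow>ys. Poly_Mapping.lookup x v) \<le> M * N * Poly_Mapping.lookup (projB e) v"
    using dil_le_mult[OF N(2), of M] by (rule dil_leE) blast
  \<comment> \<open>\<open>N * M\<close> serves as a common denominator, and
    \<open>l \<le> k\<close> makes the truncated \<open>k - l\<close> exact.\<close>
  have "dil_le (projA -` U \<union> projB -` V) (N * M) (k * (N * M)) e"
  proof (rule dil_leI[of "map expA xs @ map expB ys"])
    have "N * (l * M) + M * ((k - l) * N) = (l + (k - l)) * (N * M)"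
      by (simp only: distrib_left distrib_right mult_ac)
    then show "length (map expA xs @ map expB ys) = k * (N * M)" using xs(1) ys(1) l by simp
    show "set (map expA xs @ map expB ys) \<subseteq> projA -` U \<union> projB -` V"
      using xs(2) ys(2) by auto
    fix v :: "'x + 'y"
    show "(\<Sum>x\<leftarrow>map expA xs @ map expB ys. Poly_Mapping.lookup x v) \<le> N * M * Poly_Mapping.lookup e v"
    proof (cases v)
      case (Inl x)
      then show ?thesis using xs(3)[of x] by (simp add: o_def)
    next
      case (Inr y)
      then show ?thesis using ys(3)[of y] by (simp add: o_def mult_ac)
    qed
  qed
  then show "e \<in> ?L" using M(1) N(1)
    by (auto simp: exp_sat_exp_pow intro!: exI[of _ "N * M"])
qed

section \<open>Transfer of the exponent identity to ideals\<close>

theorem theorem2p5: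
  fixes I :: "('x::finite, 'k::field) mpoly set"
    and J :: "('y::finite, 'k) mpoly set"
  assumes "monomial_ideal I" and "monomial_ideal J"
    and "\<forall>\<alpha>. \<exists>z::int. nu_star I \<alpha> = ereal (of_int z)"
  shows "int_closure (ideal_pow (ideal_sum (extA I :: ('x + 'y, 'k) mpoly set) (extB J)) k)
       = ideal_Sum (\<lambda>l. ideal_prod (extA (int_closure (ideal_pow I l)) :: ('x + 'y, 'k) mpoly set)
                                     (extB (int_closure (ideal_pow J (k - l))))) {0..k}"
proof -
  obtain U where U: "upset U" "I = mono_span U" by (rule monomial_ideal_eq_mono_span[OF assms(1)])
  obtain V where V: "upset V" "J = mono_span V" by (rule monomial_ideal_eq_mono_span[OF assms(2)])
  let ?W = "projA -` U \<union> projB -` V :: ('x + 'y \<Rightarrow>\<^sub>0 nat) set"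
  have up: "upset (projA -` U :: ('x + 'y \<Rightarrow>\<^sub>0 nat) set)" "upset (projB -` V :: ('x + 'y \<Rightarrow>\<^sub>0 nat) set)"
    by (simp_all add: upset_vimage_proj U(1) V(1))
  \<comment> \<open>Writing the two ideals as a family over the booleans lets
    \<open>ideal_Union_mono_span\<close> compute their sum.\<close>
  have "ideal_sum (extA I :: ('x + 'y, 'k) mpoly set) (extB J) =
      ideal_of (\<Union>b\<in>{True, False}. mono_span (if b then projA -` U else projB -` V))"
    unfolding ideal_sum_def U(2) V(2) extA_mono_span[OF U(1)] extB_mono_span[OF V(1)] by simp
  also have "\<dots> = mono_span ?W"
    using up by (subst ideal_Union_mono_span) (auto simp: Un_commute)
  finally have sum_eq: "ideal_sum (extA I :: ('x + 'y, 'k) mpoly set) (extB J) = mono_span ?W" .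
  have "upset ?W" using up unfolding upset_def by blast
  then have L: "int_closure (ideal_pow (ideal_sum (extA I :: ('x + 'y, 'k) mpoly set) (extB J)) k)
      = mono_span (exp_sat (exp_pow ?W k))"
    unfolding sum_eq by (simp add: ideal_pow_mono_span int_closure_mono_span)
  have "ideal_prod (extA (int_closure (ideal_pow I l)) :: ('x + 'y, 'k) mpoly set)
        (extB (int_closure (ideal_pow J (k - l)))) =
      mono_span (projA -` exp_sat (exp_pow U l) \<inter> projB -` exp_sat (exp_pow V (k - l)))" for l
    unfolding U(2) V(2) ideal_pow_mono_span[OF U(1)] ideal_pow_mono_span[OF V(1)]
    by (simp add: int_closure_mono_span prod_ext_mono_span)
  moreover have "upset (projA -` exp_sat (exp_pow U l) \<inter>
      projB -` exp_sat (exp_pow V (k - l)) :: ('x + 'y \<Rightarrow>\<^sub>0 nat) set)" for l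
    by (intro upset_Int upset_vimage_proj upset_exp_sat)
  ultimately have R: "ideal_Sum (\<lambda>l. ideal_prod (extA (int_closure (ideal_pow I l)) :: ('x + 'y, 'k) mpoly set)
        (extB (int_closure (ideal_pow J (k - l))))) {0..k} =
      mono_span (\<Union>l\<in>{0..k}. projA -` exp_sat (exp_pow U l) \<inter> projB -` exp_sat (exp_pow V (k - l)))"
    unfolding ideal_Sum_def by (simp add: ideal_Union_mono_span)
  have "exp_sat (exp_pow ?W k) =
      (\<Union>l\<in>{0..k}. projA -` exp_sat (exp_pow U l) \<inter> projB -` exp_sat (exp_pow V (k - l)))"
  proof (rule exp_sat_exp_pow_sum)
    fix a :: "'x \<Rightarrow>\<^sub>0 nat"
    obtain z :: int where "nu_star I (Poly_Mapping.lookup a) = ereal (of_int z)" using assms(3) by blast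
    from nu_star_integral[OF this[unfolded U(2)]]
    show "\<exists>\<nu>. (\<forall>N p. 1 \<le> N \<longrightarrow> dil_le U N p a \<longrightarrow> p \<le> \<nu> * N) \<and> (\<exists>N\<ge>1. dil_le U N (\<nu> * N) a)" ..
  qed
  then show ?thesis unfolding L R by simp
qed

end
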